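(* Consider the contextual bilateral trade problem in the one-bit feedback model. There exists an efficiency-maximizing algorithm that achieves regret $O(d\,6^d)$ and enforces per-round budget balance.
   Context: Contextual bilateral trade: Let $\mathbb{B}=\{w\in\mathbb{R}^d:\|w\|_2\le 1\}$. There are two fixed vectors $s,b\in\mathbb{B}$ unknown to the learner. At each time $t=1,\dots,T$, the learner observes a context $x_t\in\mathbb{B}$ (the contexts and $s,b$ are fixed in advance by an oblivious adversary; this is an instance), and posts a price $p_t$ to the seller and $q_t$ to the buyer. Valuations: $s_t=\langle s,x_t\rangle$, $b_t=\langle b,x_t\rangle$; the trade happens iff $s_t\le p_t$ and $q_t\le b_t$. Gain from trade: $\mathrm{GFT}_t(p_t,q_t)=(b_t-s_t)\,\mathbb{1}\{s_t\le p_t\}\mathbb{1}\{q_t\le b_t\}$. One-bit feedback: after each round the learner observes only $\mathbb{1}\{s_t\le p_t\}\cdot\mathbb{1}\{q_t\le b_t\}$. Regret of a (possibly randomized) algorithm $\mathcal{A}$: $R_T(\mathcal{A})=\sup_{\mathcal{I}}\mathbb{E}\big[\sum_{t=1}^T (b_t-s_t)_+-\sum_{t=1}^T\mathrm{GFT}_t(p_t,q_t)\big]$, expectation over the algorithm's randomness. Per-round budget balance: $p_t\le q_t$ for every $t$. The $O(\cdot)$ hides absolute constants independent of $d$ and $T$. *)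

theory Defs
  imports "HOL-Probability.Probability"
begin

text \<open>Vectors of R^d are represented as functions nat => real; only the
coordinates 0..d-1 matter.\<close>
type_synonym vec = "nat \<Rightarrow> real"

definition inner_d :: "nat \<Rightarrow> vec \<Rightarrow> vec \<Rightarrow> real" where
  "inner_d d u v = (\<Sum>i<d. u i * v i)"

definition in_unit_ball :: "nat \<Rightarrow> vec \<Rightarrow> bool" where
  "in_unit_ball d v \<longleftrightarrow> sqrt (\<Sum>i<d. (v i)^2) \<le> 1"

text \<open>A deterministic learning policy: given the contexts x_0..x_t observed
so far (including the current one) and the one-bit feedbacks of rounds
0..t-1, it outputs the pair (p_t, q_t) of prices (seller price, buyer price).
Rounds are indexed from 0.\<close>
type_synonym policy = "vec list \<Rightarrow> bool list \<Rightarrow> real \<times> real"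

definition seller_val :: "nat \<Rightarrow> vec \<Rightarrow> (nat \<Rightarrow> vec) \<Rightarrow> nat \<Rightarrow> real" where
  "seller_val d s x t = inner_d d s (x t)"

definition buyer_val :: "nat \<Rightarrow> vec \<Rightarrow> (nat \<Rightarrow> vec) \<Rightarrow> nat \<Rightarrow> real" where
  "buyer_val d b x t = inner_d d b (x t)"

fun feedback_hist :: "nat \<Rightarrow> policy \<Rightarrow> vec \<Rightarrow> vec \<Rightarrow> (nat \<Rightarrow> vec) \<Rightarrow> nat \<Rightarrow> bool list" where
  "feedback_hist d \<pi> s b x 0 = []"
| "feedback_hist d \<pi> s b x (Suc n) =
     (let pq = \<pi> (map x [0..<Suc n]) (feedback_hist d \<pi> s b x n)
      in feedback_hist d \<pi> s b x n @
           [seller_val d s x n \<le> fst pq \<and> snd pq \<le> buyer_val d b x n])"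

definition prices :: "nat \<Rightarrow> policy \<Rightarrow> vec \<Rightarrow> vec \<Rightarrow> (nat \<Rightarrow> vec) \<Rightarrow> nat \<Rightarrow> real \<times> real" where
  "prices d \<pi> s b x t = \<pi> (map x [0..<Suc t]) (feedback_hist d \<pi> s b x t)"

definition gft :: "nat \<Rightarrow> policy \<Rightarrow> vec \<Rightarrow> vec \<Rightarrow> (nat \<Rightarrow> vec) \<Rightarrow> nat \<Rightarrow> real" where
  "gft d \<pi> s b x t =
     (buyer_val d b x t - seller_val d s x t) *
     (if seller_val d s x t \<le> fst (prices d \<pi> s b x t) then 1 else 0) *
     (if snd (prices d \<pi> s b x t) \<le> buyer_val d b x t then 1 else 0)"

definition total_gft :: "nat \<Rightarrow> policy \<Rightarrow> vec \<Rightarrow> vec \<Rightarrow> (nat \<Rightarrow> vec) \<Rightarrow> nat \<Rightarrow> real" where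
  "total_gft d \<pi> s b x T = (\<Sum>t<T. gft d \<pi> s b x t)"

definition optimal_gft :: "nat \<Rightarrow> vec \<Rightarrow> vec \<Rightarrow> (nat \<Rightarrow> vec) \<Rightarrow> nat \<Rightarrow> real" where
  "optimal_gft d s b x T = (\<Sum>t<T. max 0 (buyer_val d b x t - seller_val d s x t))"

definition valid_instance :: "nat \<Rightarrow> vec \<Rightarrow> vec \<Rightarrow> (nat \<Rightarrow> vec) \<Rightarrow> nat \<Rightarrow> bool" where
  "valid_instance d s b x T \<longleftrightarrow>
     in_unit_ball d s \<and> in_unit_ball d b \<and> (\<forall>t<T. in_unit_ball d (x t))"

text \<open>A randomized algorithm is a probability measure over deterministic
policies (oblivious adversary).  Its expected regret on an instance:\<close>
definition expected_regret :: "nat \<Rightarrow> policy measure \<Rightarrow> vec \<Rightarrow> vec \<Rightarrow> (nat \<Rightarrow> vec) \<Rightarrow> nat \<Rightarrow> real" where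
  "expected_regret d M s b x T =
     optimal_gft d s b x T - (\<integral>\<pi>. total_gft d \<pi> s b x T \<partial>M)"

definition budget_balanced :: "nat \<Rightarrow> policy \<Rightarrow> bool" where
  "budget_balanced d \<pi> \<longleftrightarrow>
     (\<forall>s b x T t. valid_instance d s b x T \<and> t < T \<longrightarrow>
        fst (prices d \<pi> s b x t) \<le> snd (prices d \<pi> s b x t))"

end

theory Submission
  imports Defs
begin

text \<open>
  Price at multiple scales. At scale \<open>4\<^sup>-\<^sup>i\<close> a finite net of hypotheses for the pair
  \<open>(s, b)\<close> predicts the trading interval of the current context up to an error
  \<open>4\<^sup>-\<^sup>i\<close>, and every scale has one hypothesis that is never off by more. Weights on
  the hypotheses are updated multiplicatively, so that the weighted sum over the scales
  (with factor \<open>2\<^sup>-\<^sup>i\<close>) of \<open>- ln\<close> of the weights of the correct hypotheses is a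
  potential of initial size \<open>O(d\<^sup>2)\<close>.

  A price of which a fixed fraction of the weight is sure that it trades is posted at once; if it does
  not trade, that fraction is refuted and the potential drops by a multiple of the lost gain.
  Otherwise a random price is posted, and a trade at it contradicts almost all of the weight. The chance
  of such a trade has to be of order \<open>gap / 4\<^sup>-\<^sup>j\<close> for the finest useful scale \<open>j\<close>, so a
  second family of weights confines the search: hypotheses with a gap below the resolution call only a
  short range of prices plausible, and a trade outside the range preferred by most of them is again
  progress. Both cases bound the expected loss of a round by the expected drop of the
  potential plus \<open>O(4\<^sup>-\<^sup>t)\<close>. Posting the same price to both sides balances the budget.
\<close>

section \<open>Multiplicative weights over scales\<close>

text \<open>This is the multiplicative update for sleeping experts: hypotheses outside
  \<open>A\<close> abstain and keep their weight, and the last factor restores the total mass of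
  \<open>A\<close> after the doubling on \<open>F\<close>.\<close>

definition boost :: "('e \<Rightarrow> real) \<Rightarrow> 'e set \<Rightarrow> 'e set \<Rightarrow> 'e \<Rightarrow> real" where
  "boost w A F e =
     (if e \<in> A then w e * (if e \<in> F then 2 else 1) * (sum w A / (sum w A + sum w (A \<inter> F))) else w e)"

lemma boost_pos:
  assumes "finite A" "\<And>e. e \<in> A \<Longrightarrow> w e > 0" "w e > 0"
  shows "boost w A F e > 0"
proof (cases "e \<in> A")
  case True
  have "sum w A > 0"
    using True assms(1,2) by (intro sum_pos) auto
  moreover have "sum w (A \<inter> F) \<ge> 0"
    using assms(2) by (intro sum_nonneg) (auto intro: less_imp_le)
  ultimately show ?thesis
    using assms(3) True by (auto simp: boost_def intro!: mult_pos_pos divide_pos_pos)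
next
  case False
  then show ?thesis using assms by (simp add: boost_def)
qed

lemma sum_boost:
  assumes "finite X" "A \<subseteq> X" "\<And>e. e \<in> A \<Longrightarrow> w e > 0"
  shows "sum (boost w A F) X = sum w X"
proof -
  have fin: "finite A"
    using assms finite_subset by blast
  have "sum (boost w A F) A = sum w A"
  proof (cases "A = {}")
    case False
    have pos: "sum w A > 0"
      using False fin assms(3) by (simp add: sum_pos)
    have nn: "sum w (A \<inter> F) \<ge> 0"
      using assms(3) by (intro sum_nonneg) (auto intro: less_imp_le)
    have "sum (boost w A F) A
        = (\<Sum>e\<in>A. w e * (if e \<in> F then 2 else 1)) * (sum w A / (sum w A + sum w (A \<inter> F)))"
      unfolding sum_distrib_right by (intro sum.cong) (auto simp: boost_def)
    also have "(\<Sum>e\<in>A. w e * (if e \<in> F then 2 else 1)) = (\<Sum>e\<in>A. w e + (if e \<in> F then w e else 0))"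
      by (intro sum.cong) auto
    also have "\<dots> = sum w A + sum w (A \<inter> F)"
      by (simp add: sum.distrib sum.inter_restrict[OF fin])
    finally have "sum (boost w A F) A
        = (sum w A + sum w (A \<inter> F)) * (sum w A / (sum w A + sum w (A \<inter> F)))" .
    moreover have "sum w A + sum w (A \<inter> F) \<noteq> 0"
      using pos nn by linarith
    ultimately show ?thesis
      by simp
  qed simp
  moreover have "sum (boost w A F) (X - A) = sum w (X - A)"
    by (intro sum.cong) (auto simp: boost_def)
  ultimately show ?thesis
    using sum.subset_diff[OF assms(2,1), of "boost w A F"] sum.subset_diff[OF assms(2,1), of w] by simp
qed

text \<open>The normalising factor is at least \<open>1 / (1 + \<phi>)\<close>, where
  \<open>\<phi>\<close> bounds the share of \<open>F\<close> in \<open>A\<close>. A rare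
  \<open>F\<close> therefore rewards its members by almost \<open>ln 2\<close> and costs the others
  no more than its share.\<close>

lemma ln_boost:
  assumes "finite A" "\<And>e. e \<in> A \<Longrightarrow> w e > 0" "e \<in> A" and phi: "sum w (A \<inter> F) \<le> \<phi> * sum w A"
  shows "ln (boost w A F e) - ln (w e) \<ge> (if e \<in> F then ln (2 / (1 + \<phi>)) else - \<phi>)"
proof -
  have pos: "sum w A > 0"
    using assms(1-3) by (intro sum_pos) auto
  have nn: "sum w (A \<inter> F) \<ge> 0"
    using assms(2) by (intro sum_nonneg) (auto intro: less_imp_le)
  have phi0: "\<phi> \<ge> 0"
    using order_trans[OF nn phi] pos by (simp add: zero_le_mult_iff)
  have q: "sum w A / (sum w A + sum w (A \<inter> F)) \<ge> 1 / (1 + \<phi>)"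
  proof -
    have "sum w A + sum w (A \<inter> F) \<le> sum w A * (1 + \<phi>)"
      using phi by (simp add: algebra_simps)
    then show ?thesis
      using pos nn phi0 by (simp add: field_simps)
  qed
  let ?c = "if e \<in> F then 2 else 1 :: real"
  have we: "w e > 0"
    using assms by auto
  have cq: "?c * (sum w A / (sum w A + sum w (A \<inter> F))) \<ge> ?c / (1 + \<phi>)"
    using mult_left_mono[OF q, of ?c] by simp
  have "ln (?c / (1 + \<phi>)) \<le> ln (?c * (sum w A / (sum w A + sum w (A \<inter> F))))"
    by (rule ln_mono[OF cq]) (use phi0 in auto)
  also have "\<dots> = ln (boost w A F e) - ln (w e)"
  proof -
    have "boost w A F e = w e * (?c * (sum w A / (sum w A + sum w (A \<inter> F))))"
      using assms(3) by (simp add: boost_def)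
    moreover have "?c * (sum w A / (sum w A + sum w (A \<inter> F))) > 0"
      using pos nn by (auto intro!: mult_pos_pos divide_pos_pos)
    ultimately show ?thesis
      using we by (simp only: ln_mult_pos)
  qed
  finally have main: "ln (?c / (1 + \<phi>)) \<le> ln (boost w A F e) - ln (w e)" .
  show ?thesis
  proof (cases "e \<in> F")
    case True
    then show ?thesis using main by simp
  next
    case False
    have "ln (1 / (1 + \<phi>)) = - ln (1 + \<phi>)"
      using phi0 by (simp add: ln_div)
    moreover have "ln (1 + \<phi>) \<le> \<phi>"
      using phi0 by (rule ln_add_one_self_le_self)
    ultimately show ?thesis using main False by simp
  qed
qed

text \<open>
  \<open>l h\<close> and \<open>r h\<close> are the seller and buyer values predicted by hypothesis \<open>h\<close>. Membership in
  \<open>core\<close> means that \<open>h\<close> is sure of a trade at \<open>p\<close> in spite of its tolerance \<open>4\<^sup>-\<^sup>i\<close>,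
  and \<open>plausible\<close> that it does not exclude one.
\<close>

definition active :: "(nat \<Rightarrow> 'h set) \<Rightarrow> nat \<Rightarrow> ('h \<Rightarrow> real) \<Rightarrow> ('h \<Rightarrow> real) \<Rightarrow> (nat \<times> 'h) set" where
  "active H t l r = {(i, h). i \<le> t \<and> h \<in> H i \<and> 126 / 4 ^ i \<le> r h - l h}"

definition core :: "('h \<Rightarrow> real) \<Rightarrow> ('h \<Rightarrow> real) \<Rightarrow> real \<Rightarrow> (nat \<times> 'h) set" where
  "core l r p = {(i, h). l h + 1 / 4 ^ i \<le> p \<and> p \<le> r h - 1 / 4 ^ i}"

definition awake :: "(nat \<Rightarrow> 'h set) \<Rightarrow> ('h \<Rightarrow> real) \<Rightarrow> ('h \<Rightarrow> real) \<Rightarrow> nat \<Rightarrow> 'h set" where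
  "awake H l r j = {h \<in> H j. r h - l h \<le> 4 / 4 ^ j}"

definition plausible :: "('h \<Rightarrow> real) \<Rightarrow> ('h \<Rightarrow> real) \<Rightarrow> nat \<Rightarrow> real \<Rightarrow> 'h set" where
  "plausible l r j p = {h. l h - 1 / 4 ^ j \<le> p \<and> p \<le> r h + 1 / 4 ^ j}"

definition endorsed :: "(nat \<Rightarrow> 'h set) \<Rightarrow> nat \<Rightarrow> ('h \<Rightarrow> real) \<Rightarrow> ('h \<Rightarrow> real) \<Rightarrow> (nat \<times> 'h \<Rightarrow> real) \<Rightarrow> real \<Rightarrow> bool" where
  "endorsed H t l r W p \<longleftrightarrow> sum W (active H t l r) / 1000 < sum W (active H t l r \<inter> core l r p)"

definition price_grid :: "nat \<Rightarrow> real set" where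
  "price_grid t = {p. \<bar>p\<bar> \<le> 1 \<and> (\<exists>k::int. p = k / 4 ^ t)}"

text \<open>With no awake hypothesis of positive weight both sums vanish and every price survives: a
  level filters only if some hypothesis predicts a small gap.\<close>

fun candidates :: "(nat \<Rightarrow> 'h set) \<Rightarrow> nat \<Rightarrow> ('h \<Rightarrow> real) \<Rightarrow> ('h \<Rightarrow> real) \<Rightarrow> (nat \<Rightarrow> 'h \<Rightarrow> real) \<Rightarrow> nat \<Rightarrow> real set" where
  "candidates H t l r V 0 = price_grid t"
| "candidates H t l r V (Suc j) =
     {p \<in> candidates H t l r V j. sum (V j) (awake H l r j) \<le> 2 * sum (V j) (awake H l r j \<inter> plausible l r j p)}"

type_synonym seed = "nat \<times> nat \<times> nat"

text \<open>
  A seed \<open>(j, k, c)\<close> asks for the \<open>k\<close>-th candidate of level \<open>j\<close>. The dummy component \<open>c\<close> makes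
  level \<open>j\<close> come up with probability proportional to \<open>2\<^sup>-\<^sup>j\<close>, and each of its prices with
  probability proportional to \<open>2\<^sup>j\<close>.
\<close>

definition seeds :: "nat \<Rightarrow> seed set" where
  "seeds t = (SIGMA j:{..t}. {..<56 * 4 ^ (t - j)} \<times> {..<2 ^ j})"

type_synonym 'h weights = "(nat \<times> 'h \<Rightarrow> real) \<times> (nat \<Rightarrow> 'h \<Rightarrow> real)"

text \<open>
  The price \<open>2\<close> exceeds every value and stands for not exploring.
\<close>

definition post :: "(nat \<Rightarrow> 'h set) \<Rightarrow> nat \<Rightarrow> ('h \<Rightarrow> real) \<Rightarrow> ('h \<Rightarrow> real) \<Rightarrow> 'h weights \<Rightarrow> seed \<Rightarrow> real" where
  "post H t l r = (\<lambda>(W, V) (j, k, c).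
     if \<exists>p. endorsed H t l r W p then SOME p. endorsed H t l r W p
     else if k < card (candidates H t l r V j) then sorted_list_of_set (candidates H t l r V j) ! k
     else 2)"

text \<open>
  The weights \<open>W\<close> change only on a surprise: a failed endorsed price, or a trade at an explored one.
\<close>

definition learn :: "(nat \<Rightarrow> 'h set) \<Rightarrow> nat \<Rightarrow> ('h \<Rightarrow> real) \<Rightarrow> ('h \<Rightarrow> real) \<Rightarrow> 'h weights \<Rightarrow> real \<Rightarrow> bool \<Rightarrow> 'h weights" where
  "learn H t l r = (\<lambda>(W, V) p y.
     (if (\<exists>p. endorsed H t l r W p) = y then W
      else boost W (active H t l r) (if y then core l r p else - core l r p),
      if y then \<lambda>j. boost (V j) (awake H l r j) (plausible l r j p) else V))"

text \<open>The factor \<open>1 / 2 ^ i\<close> makes the initial value bounded independently of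
  \<open>T\<close>, and the \<open>2 ^ j\<close> copies of each seed of level \<open>j\<close>
  cancel it on average.\<close>

definition potential :: "nat \<Rightarrow> (nat \<Rightarrow> 'h) \<Rightarrow> 'h weights \<Rightarrow> real" where
  "potential T h = (\<lambda>(W, V). \<Sum>i\<le>T. (- ln (W (i, h i)) - ln (V i (h i))) / 2 ^ i)"

section \<open>Counting grid prices in an interval\<close>

lemma price_grid_bounds: "p \<in> price_grid t \<Longrightarrow> -1 \<le> p" "p \<in> price_grid t \<Longrightarrow> p \<le> 1"
  unfolding price_grid_def mem_Collect_eq by linarith+

lemma price_grid_interval:
  assumes "-1 \<le> a" "b \<le> 1"
  shows "{p \<in> price_grid t. a \<le> p \<and> p \<le> b} = (\<lambda>k::int. k / 4 ^ t) ` {\<lceil>a * 4 ^ t\<rceil>..\<lfloor>b * 4 ^ t\<rfloor>}"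
proof (intro set_eqI iffI)
  fix p assume "p \<in> {p \<in> price_grid t. a \<le> p \<and> p \<le> b}"
  then obtain k :: int where k: "p = k / 4 ^ t" "a \<le> p" "p \<le> b"
    by (auto simp: price_grid_def)
  have "a * 4 ^ t \<le> p * 4 ^ t" "p * 4 ^ t \<le> b * 4 ^ t"
    using mult_right_mono[OF k(2), of "4 ^ t"] mult_right_mono[OF k(3), of "4 ^ t"] by simp_all
  then have "a * 4 ^ t \<le> k" "k \<le> b * 4 ^ t"
    by (simp_all add: k(1))
  then show "p \<in> (\<lambda>k::int. k / 4 ^ t) ` {\<lceil>a * 4 ^ t\<rceil>..\<lfloor>b * 4 ^ t\<rfloor>}"
    using k(1) by (auto simp: ceiling_le_iff le_floor_iff)
next
  fix p assume "p \<in> (\<lambda>k::int. k / 4 ^ t) ` {\<lceil>a * 4 ^ t\<rceil>..\<lfloor>b * 4 ^ t\<rfloor>}"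
  then obtain k :: int where k: "p = k / 4 ^ t" "\<lceil>a * 4 ^ t\<rceil> \<le> k" "k \<le> \<lfloor>b * 4 ^ t\<rfloor>"
    by auto
  then have "a * 4 ^ t \<le> k" "k \<le> b * 4 ^ t"
    by (auto simp: ceiling_le_iff le_floor_iff)
  then have "a \<le> p" "p \<le> b"
    using k(1) by (simp_all add: pos_le_divide_eq pos_divide_le_eq)
  moreover from this have "\<bar>p\<bar> \<le> 1"
    using assms by linarith
  ultimately show "p \<in> {p \<in> price_grid t. a \<le> p \<and> p \<le> b}"
    unfolding price_grid_def mem_Collect_eq using k(1) by blast
qed

lemma finite_price_grid: "finite (price_grid t)"
proof -
  have "price_grid t = {p \<in> price_grid t. -1 \<le> p \<and> p \<le> 1}"
    using price_grid_bounds by blast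
  also have "finite \<dots>"
    by (subst price_grid_interval) auto
  finally show ?thesis .
qed

lemma card_price_grid_interval:
  assumes "-1 \<le> a" "b \<le> 1"
  shows "card {p \<in> price_grid t. a \<le> p \<and> p \<le> b} = nat (\<lfloor>b * 4 ^ t\<rfloor> - \<lceil>a * 4 ^ t\<rceil> + 1)"
proof -
  have "inj_on (\<lambda>k::int. k / 4 ^ t :: real) X" for X
    by (auto simp: inj_on_def)
  then show ?thesis
    by (simp add: price_grid_interval[OF assms] card_image)
qed

lemma card_price_grid_interval_ge:
  assumes "-1 \<le> a" "b \<le> 1"
  shows "(b - a) * 4 ^ t - 1 \<le> card {p \<in> price_grid t. a \<le> p \<and> p \<le> b}"
proof -
  have "(b - a) * 4 ^ t - 1 \<le> real_of_int (\<lfloor>b * 4 ^ t\<rfloor> - \<lceil>a * 4 ^ t\<rceil> + 1)"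
    unfolding left_diff_distrib of_int_diff of_int_add by linarith
  then show ?thesis
    by (simp add: card_price_grid_interval[OF assms])
qed

lemma card_price_grid_interval_le:
  fixes a b :: real
  assumes "a \<le> b"
  shows "card {p \<in> price_grid t. a \<le> p \<and> p \<le> b} \<le> (b - a) * 4 ^ t + 1"
proof -
  \<comment> \<open>Clipping to the range of the grid loses no price and makes the exact count
    applicable.\<close>
  define a' b' :: real where "a' = max a (-1)" and "b' = min b 1"
  define z where "z = \<lfloor>b' * 4 ^ t\<rfloor> - \<lceil>a' * 4 ^ t\<rceil> + 1"
  have "{p \<in> price_grid t. a \<le> p \<and> p \<le> b} = {p \<in> price_grid t. a' \<le> p \<and> p \<le> b'}"
    using price_grid_bounds by (auto simp: a'_def b'_def)
  moreover have "card {p \<in> price_grid t. a' \<le> p \<and> p \<le> b'} = nat z"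
    unfolding z_def by (rule card_price_grid_interval) (auto simp: a'_def b'_def)
  moreover have "real_of_int z \<le> (b - a) * 4 ^ t + 1"
  proof -
    have "real_of_int z \<le> (b' - a') * 4 ^ t + 1"
      unfolding z_def left_diff_distrib of_int_diff of_int_add by linarith
    also have "(b' - a') * 4 ^ t \<le> (b - a) * 4 ^ t"
      by (intro mult_right_mono) (auto simp: a'_def b'_def)
    finally show ?thesis by simp
  qed
  moreover have "(b - a) * 4 ^ t \<ge> 0"
    using assms by simp
  ultimately show ?thesis
    by (cases "z \<ge> 0") simp_all
qed

section \<open>Counting seeds\<close>

lemma finite_seeds: "finite (seeds t)"
  by (simp add: seeds_def)

lemma sum_seeds: "(\<Sum>u\<in>seeds t. f (fst u) (fst (snd u))) = (\<Sum>j\<le>t. 2 ^ j * (\<Sum>k<56 * 4 ^ (t - j). f j k :: real))"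
proof -
  have "(\<Sum>u\<in>seeds t. f (fst u) (fst (snd u)))
      = (\<Sum>j\<le>t. \<Sum>kc\<in>{..<56 * 4 ^ (t - j)} \<times> {..<(2::nat) ^ j}. f j (fst kc))"
    unfolding seeds_def by (subst sum.Sigma) (auto intro!: sum.cong split: prod.splits)
  also have "\<dots> = (\<Sum>j\<le>t. \<Sum>k<56 * 4 ^ (t - j). \<Sum>c<(2::nat) ^ j. f j k)"
    by (intro sum.cong refl) (simp only: sum.cartesian_product case_prod_unfold)
  also have "\<dots> = (\<Sum>j\<le>t. 2 ^ j * (\<Sum>k<56 * 4 ^ (t - j). f j k))"
    by (simp add: sum_distrib_left mult.commute)
  finally show ?thesis .
qed

lemma geometric_half_sum: "(\<Sum>j\<le>t. 1 / 2 ^ j) = (2 - 1 / 2 ^ t :: real)"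
  by (induction t) (auto simp: field_simps)

lemma power_four_diff: "j \<le> t \<Longrightarrow> 4 ^ (t - j) = (4 ^ t / 4 ^ j :: real)"
  by (simp add: power_diff)

lemma two_four: "(4::real) ^ j = 2 ^ j * 2 ^ j"
  by (simp flip: power_mult_distrib)

text \<open>From one level to the next the prices become four times fewer and their copies twice as
  many, so level \<open>j\<close> contributes \<open>56 * 4 ^ t / 2 ^ j\<close> and level 0 alone at
  least half of the total.\<close>

lemma card_seeds: "56 * 4 ^ t \<le> real (card (seeds t))" "real (card (seeds t)) \<le> 112 * 4 ^ t"
proof -
  have "real (card (seeds t)) = (\<Sum>j\<le>t. 2 ^ j * (56 * 4 ^ (t - j)))"
    using sum_seeds[of "\<lambda>_ _. 1" t] by simp
  also have "\<dots> = (\<Sum>j\<le>t. 56 * 4 ^ t * (1 / 2 ^ j))"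
  proof (intro sum.cong refl)
    fix j assume "j \<in> {..t}"
    then have "4 ^ (t - j) = (4 ^ t / (2 ^ j * 2 ^ j) :: real)"
      by (simp only: power_four_diff atMost_iff two_four[of j])
    then show "2 ^ j * (56 * 4 ^ (t - j)) = 56 * 4 ^ t * (1 / 2 ^ j :: real)"
      by simp
  qed
  also have "\<dots> = 56 * 4 ^ t * (2 - 1 / 2 ^ t)"
    by (simp only: flip: sum_distrib_left geometric_half_sum)
  finally have *: "real (card (seeds t)) = 56 * 4 ^ t * (2 - 1 / 2 ^ t)" .
  have "(1::real) / 2 ^ t \<le> 1" "(1::real) / 2 ^ t \<ge> 0"
    by auto
  then have "56 * 4 ^ t * 1 \<le> 56 * 4 ^ t * (2 - 1 / 2 ^ t :: real)" "56 * 4 ^ t * (2 - 1 / 2 ^ t :: real) \<le> 56 * 4 ^ t * 2"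
    by (intro mult_left_mono; simp)+
  then show "56 * 4 ^ t \<le> real (card (seeds t))" "real (card (seeds t)) \<le> 112 * 4 ^ t"
    unfolding * by auto
qed

section \<open>Potential drop in one round\<close>

text \<open>A single round with the weights before it: \<open>h i\<close> is the correct hypothesis
  of scale \<open>i\<close>, and \<open>sv\<close>, \<open>bv\<close> are the true values.\<close>

locale trade_round =
  fixes H :: "nat \<Rightarrow> 'h set" and t T :: nat and l r :: "'h \<Rightarrow> real"
    and W :: "nat \<times> 'h \<Rightarrow> real" and V :: "nat \<Rightarrow> 'h \<Rightarrow> real"
    and sv bv :: real and h :: "nat \<Rightarrow> 'h"
  assumes finite_H: "finite (H i)"
    and W_pos: "a \<in> H i \<Longrightarrow> W (i, a) > 0" and V_pos: "a \<in> H i \<Longrightarrow> V i a > 0"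
    and h_in: "h i \<in> H i"
    and l_close: "\<bar>l (h i) - sv\<bar> \<le> 1 / 4 ^ i" and r_close: "\<bar>r (h i) - bv\<bar> \<le> 1 / 4 ^ i"
    and vals: "\<bar>sv\<bar> \<le> 1" "\<bar>bv\<bar> \<le> 1"
    and t_le: "t \<le> T"
begin

abbreviation "Act \<equiv> active H t l r"
abbreviation "Aw \<equiv> awake H l r"
abbreviation "Q \<equiv> candidates H t l r V"
abbreviation "decrease p y \<equiv> potential T h (W, V) - potential T h (learn H t l r (W, V) p y)"

lemma finite_active: "finite Act"
proof (rule finite_subset)
  show "Act \<subseteq> Sigma {..t} H"
    by (auto simp: active_def)
qed (use finite_H in auto)

lemma active_pos: "e \<in> Act \<Longrightarrow> W e > 0"
  using W_pos by (auto simp: active_def)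

lemma finite_awake: "finite (Aw j)"
  using finite_H by (simp add: awake_def)

lemma awake_pos: "a \<in> Aw j \<Longrightarrow> V j a > 0"
  using V_pos by (auto simp: awake_def)

text \<open>Each predicted value is off by at most \<open>1 / 4 ^ i\<close>, hence the predicted gap
  by at most \<open>2 / 4 ^ i\<close>. This is the slack between 124, 126 and 128 here and in the
  next lemma, and between 2 and 4 in \<open>awake_truthI\<close>.\<close>

lemma active_truthD:
  assumes "(i, h i) \<in> Act"
  shows "i \<le> t" "124 / 4 ^ i \<le> bv - sv"
proof -
  have *: "126 / 4 ^ i \<le> r (h i) - l (h i)"
    using assms by (simp add: active_def)
  show "i \<le> t"
    using assms by (simp add: active_def)
  have "(124::real) / 4 ^ i = 126 / 4 ^ i - 2 * (1 / 4 ^ i)"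
    by (simp add: field_simps)
  then show "124 / 4 ^ i \<le> bv - sv"
    using * l_close[of i] r_close[of i] by linarith
qed

lemma active_truthI:
  assumes "i \<le> t" "128 / 4 ^ i \<le> bv - sv"
  shows "(i, h i) \<in> Act"
proof -
  have "(126::real) / 4 ^ i = 128 / 4 ^ i - 2 * (1 / 4 ^ i)"
    by (simp add: field_simps)
  then have "126 / 4 ^ i \<le> r (h i) - l (h i)"
    using assms l_close[of i] r_close[of i] by linarith
  then show ?thesis
    using assms h_in by (simp add: active_def)
qed

lemma awake_truthI:
  assumes "bv - sv \<le> 2 / 4 ^ j"
  shows "h j \<in> Aw j"
proof -
  have "(4::real) / 4 ^ j = 2 / 4 ^ j + 2 * (1 / 4 ^ j)"
    by (simp add: field_simps)
  then have "r (h j) - l (h j) \<le> 4 / 4 ^ j"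
    using assms l_close[of j] r_close[of j] by linarith
  then show ?thesis
    using h_in by (simp add: awake_def)
qed

lemma core_truth_trades: "(i, h i) \<in> core l r p \<Longrightarrow> sv \<le> p \<and> p \<le> bv"
  using l_close[of i] r_close[of i] unfolding core_def by auto

lemma trade_plausible: "sv \<le> p \<Longrightarrow> p \<le> bv \<Longrightarrow> h j \<in> plausible l r j p"
  using l_close[of j] r_close[of j] unfolding plausible_def by auto

definition gain_W :: "real \<Rightarrow> bool \<Rightarrow> nat \<Rightarrow> real" where
  "gain_W p y i = ln (fst (learn H t l r (W, V) p y) (i, h i)) - ln (W (i, h i))"

definition gain_V :: "real \<Rightarrow> bool \<Rightarrow> nat \<Rightarrow> real" where
  "gain_V p y i = ln (snd (learn H t l r (W, V) p y) i (h i)) - ln (V i (h i))"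

lemma decrease_eq: "decrease p y = (\<Sum>i\<le>T. gain_W p y i / 2 ^ i) + (\<Sum>i\<le>T. gain_V p y i / 2 ^ i)"
  unfolding potential_def gain_W_def gain_V_def split_def fst_conv snd_conv
    sum_subtractf[symmetric] sum.distrib[symmetric]
  by (intro sum.cong refl) (simp add: diff_divide_distrib add_divide_distrib)

lemma ln_boost_active:
  assumes "e \<in> Act" "sum W (Act \<inter> F) \<le> \<phi> * sum W Act"
  shows "ln (boost W Act F e) - ln (W e) \<ge> (if e \<in> F then ln (2 / (1 + \<phi>)) else - \<phi>)"
  by (rule ln_boost[OF finite_active active_pos assms])

lemma ln_boost_awake:
  assumes "a \<in> Aw j" "sum (V j) (Aw j \<inter> F) \<le> \<phi> * sum (V j) (Aw j)"
  shows "ln (boost (V j) (Aw j) F a) - ln (V j a) \<ge> (if a \<in> F then ln (2 / (1 + \<phi>)) else - \<phi>)"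
  by (rule ln_boost[OF finite_awake awake_pos assms])

text \<open>A price that trades is plausible for the correct hypothesis at every scale, so its
  weight is doubled if it is awake, which makes up even for the worst normalisation
  \<open>\<phi> = 1\<close>.\<close>

lemma gain_V_nonneg:
  assumes "y \<Longrightarrow> sv \<le> p \<and> p \<le> bv"
  shows "gain_V p y i \<ge> 0"
proof (cases "y \<and> h i \<in> Aw i")
  case True
  then have "h i \<in> plausible l r i p"
    using assms trade_plausible by blast
  moreover have "sum (V i) (Aw i \<inter> plausible l r i p) \<le> 1 * sum (V i) (Aw i)"
    unfolding mult_1 by (rule sum_mono2) (auto intro: finite_awake less_imp_le awake_pos)
  ultimately show ?thesis
    using True ln_boost_awake[of "h i" i "plausible l r i p" 1]
    by (simp add: gain_V_def learn_def)
next
  case False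
  then show ?thesis
    by (auto simp: gain_V_def learn_def boost_def)
qed

text \<open>Less than half of the awake weight finds a price plausible that is dropped at this
  level, so a trade at it is a surprise with \<open>\<phi> = 1 / 2\<close>.\<close>

lemma gain_V_candidate:
  assumes "sv \<le> p" "p \<le> bv" "h j \<in> Aw j" "p \<in> Q j" "p \<notin> Q (Suc j)"
  shows "gain_V p True j \<ge> 1 / 4"
proof -
  have "h j \<in> plausible l r j p"
    using assms trade_plausible by blast
  moreover have "sum (V j) (Aw j \<inter> plausible l r j p) \<le> 1 / 2 * sum (V j) (Aw j)"
    using assms(4,5) by simp
  ultimately have "ln (2 / (1 + 1 / 2)) \<le> gain_V p True j"
    using ln_boost_awake[OF assms(3), of "plausible l r j p" "1/2"]
    by (simp add: gain_V_def learn_def)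
  moreover have "(1::real) / 4 \<le> ln (4 / 3)"
    using ln_one_minus_pos_upper_bound[of "1/4"]
    by (simp add: ln_div)
  ultimately show ?thesis
    by simp
qed

text \<open>The refuted core held more than a thousandth of the active weight, so the doubled
  complement has share at most \<open>999 / 1000\<close>. It contains the correct hypothesis, whose
  core has only prices that trade.\<close>

lemma gain_W_commit_fail:
  assumes "endorsed H t l r W p" "\<not> (sv \<le> p \<and> p \<le> bv)"
  shows "gain_W p False i \<ge> (if (i, h i) \<in> Act then 1 / 2000 else 0)"
proof (cases "(i, h i) \<in> Act")
  case True
  have "(i, h i) \<in> - core l r p"
    using assms(2) core_truth_trades by blast
  moreover have "sum W (Act \<inter> - core l r p) \<le> (999 / 1000) * sum W Act"
  proof -
    have "sum W Act = sum W (Act \<inter> core l r p) + sum W (Act - core l r p)"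
      using finite_active by (rule sum.Int_Diff)
    then show ?thesis
      using assms(1) by (simp add: endorsed_def Diff_eq)
  qed
  ultimately have "ln (2 / (1 + 999 / 1000)) \<le> gain_W p False i"
    using ln_boost_active[OF True, of "- core l r p" "999/1000"] assms(1)
    by (auto simp: gain_W_def learn_def)
  \<comment> \<open>The argument of \<open>ln\<close> is \<open>1 / (1 - 1 / 2000)\<close>, and
    \<open>ln (1 - x) \<le> - x\<close>.\<close>
  moreover have "(1::real) / 2000 \<le> ln (2 / (1 + 999 / 1000))"
    using ln_one_minus_pos_upper_bound[of "1/2000"] by (simp add: ln_div)
  ultimately show ?thesis
    using True by simp
next
  case False
  then show ?thesis
    by (simp add: gain_W_def learn_def boost_def)
qed

text \<open>With nothing endorsed, the core of any price has share at most \<open>1 / 1000\<close>.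
  A trade is then worth almost \<open>ln 2\<close> where the correct hypothesis was sure of it and
  costs at most that share elsewhere.\<close>

lemma gain_W_explore_success:
  assumes none: "(\<exists>p. endorsed H t l r W p) = False"
  shows "gain_W p True i \<ge> (if (i, h i) \<notin> Act then 0 else if (i, h i) \<in> core l r p then 1 / 3 else - (1 / 1000))"
proof (cases "(i, h i) \<in> Act")
  case True
  have "sum W (Act \<inter> core l r p) \<le> 1 / 1000 * sum W Act"
    using none by (auto simp: endorsed_def not_less)
  from ln_boost_active[OF True this]
  have "(if (i, h i) \<in> core l r p then ln (2 / (1 + 1 / 1000)) else - (1 / 1000)) \<le> gain_W p True i"
    by (simp add: gain_W_def learn_def none split del: if_split)
  moreover have "(1::real) / 3 \<le> ln (2 / (1 + 1 / 1000))"
  proof -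
    have "(1::real) / 3 \<le> ln (3 / 2)"
      using ln_one_minus_pos_upper_bound[of "1/3"] by (simp add: ln_div)
    also have "\<dots> \<le> ln (2 / (1 + 1 / 1000))"
      by (rule ln_mono) auto
    finally show ?thesis .
  qed
  ultimately show ?thesis
    using True by (auto split: if_splits)
next
  case False
  then show ?thesis
    by (simp add: gain_W_def learn_def boost_def none)
qed

lemma finite_candidates: "finite (Q j)"
  by (induction j) (auto simp: finite_price_grid)

lemma candidates_subset: "Q j \<subseteq> price_grid t"
  by (induction j) auto

text \<open>Double counting of pairs of a price and a hypothesis. A surviving price is plausible for
  half of the awake weight at level \<open>i = j - 1\<close>, while an awake hypothesis allows an
  interval of length at most \<open>6 / 4 ^ i\<close>, hence at most
  \<open>7 * 4 ^ t / 4 ^ i\<close> grid prices. The correct hypothesis being awake makes the total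
  weight positive, so it can be cancelled.\<close>

lemma card_candidates:
  assumes "j \<le> t" "j = 0 \<or> h (j - 1) \<in> Aw (j - 1)"
  shows "card (Q j) \<le> 56 * 4 ^ (t - j)"
proof (cases j)
  case 0
  have "price_grid t = {p \<in> price_grid t. -1 \<le> p \<and> p \<le> 1}"
    using price_grid_bounds by blast
  then have "real (card (price_grid t)) \<le> 2 * 4 ^ t + 1"
    using card_price_grid_interval_le[of "-1" 1 t] by simp
  also have "\<dots> \<le> real (56 * 4 ^ t)"
  proof -
    have "(1::real) \<le> 4 ^ t"
      by simp
    then have "2 * 4 ^ t + 1 \<le> (56 * 4 ^ t :: real)"
      by linarith
    then show ?thesis by simp
  qed
  finally have "card (price_grid t) \<le> 56 * 4 ^ t"
    by (simp only: of_nat_le_iff)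
  then show ?thesis
    using 0 by simp
next
  case (Suc i)
  let ?pl = "\<lambda>p. Aw i \<inter> plausible l r i p"
  have aw: "h i \<in> Aw i"
    using assms Suc by simp
  have tot: "sum (V i) (Aw i) > 0"
    using aw finite_awake awake_pos by (intro sum_pos) auto
  have cnt: "real (card {p \<in> price_grid t. a \<in> plausible l r i p}) \<le> 7 * (4 ^ t / 4 ^ i)" if "a \<in> Aw i" for a
  \<comment> \<open>A net hypothesis may predict a seller value far above the buyer value; then no
    price is plausible for it.\<close>
  proof (cases "l a - 1 / 4 ^ i \<le> r a + 1 / 4 ^ i")
    case True
    have "real (card {p \<in> price_grid t. a \<in> plausible l r i p}) \<le> (r a + 1 / 4 ^ i - (l a - 1 / 4 ^ i)) * 4 ^ t + 1"
      using card_price_grid_interval_le[OF True, of t] by (simp add: plausible_def)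
    also have "\<dots> \<le> (6 / 4 ^ i) * 4 ^ t + 1"
    proof -
      have "(6::real) / 4 ^ i = 4 / 4 ^ i + 1 / 4 ^ i + 1 / 4 ^ i"
        by (simp add: field_simps)
      then show ?thesis
        using that by (intro add_right_mono mult_right_mono) (auto simp: awake_def)
    qed
    also have "(1::real) \<le> 4 ^ t / 4 ^ i"
      using assms(1) Suc by (simp add: power_increasing)
    finally show ?thesis by simp
  next
    case False
    then have "{p \<in> price_grid t. a \<in> plausible l r i p} = {}"
      by (auto simp: plausible_def)
    then show ?thesis by (simp only: card.empty) simp
  qed
  have "real (card (Q j)) * sum (V i) (Aw i) = (\<Sum>p\<in>Q j. sum (V i) (Aw i))"
    by simp
  also have "\<dots> \<le> (\<Sum>p\<in>Q j. 2 * sum (V i) (?pl p))"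
    by (intro sum_mono) (simp add: Suc)
  also have "\<dots> \<le> (\<Sum>p\<in>price_grid t. 2 * sum (V i) (?pl p))"
    by (intro sum_mono2 finite_price_grid candidates_subset mult_nonneg_nonneg sum_nonneg)
       (auto intro: less_imp_le awake_pos)
  also have "\<dots> = 2 * (\<Sum>p\<in>price_grid t. \<Sum>a\<in>Aw i. if a \<in> plausible l r i p then V i a else 0)"
    by (simp add: sum_distrib_left[symmetric] sum.inter_restrict[OF finite_awake])
  also have "\<dots> = 2 * (\<Sum>a\<in>Aw i. \<Sum>p\<in>price_grid t. if a \<in> plausible l r i p then V i a else 0)"
    by (subst sum.swap) simp
  also have "\<dots> = 2 * (\<Sum>a\<in>Aw i. V i a * card {p \<in> price_grid t. a \<in> plausible l r i p})"
    by (simp add: sum.If_cases[OF finite_price_grid] Int_def mult.commute)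
  also have "\<dots> \<le> 2 * (\<Sum>a\<in>Aw i. V i a * (7 * (4 ^ t / 4 ^ i)))"
    by (intro mult_left_mono sum_mono cnt) (auto intro: less_imp_le awake_pos)
  also have "\<dots> = (14 * (4 ^ t / 4 ^ i)) * sum (V i) (Aw i)"
    by (simp only: sum_distrib_right[symmetric] mult_ac)
  finally have "real (card (Q j)) \<le> 14 * (4 ^ t / 4 ^ i)"
    using tot by (rule mult_right_le_imp_le)
  also have "\<dots> = 56 * (4 ^ t / 4 ^ j)"
    by (simp add: Suc)
  also have "\<dots> = real (56 * 4 ^ (t - j))"
    using power_four_diff[OF assms(1)] by simp
  finally show ?thesis
    by (simp only: of_nat_le_iff)
qed

end

section \<open>Two geometric sums\<close>

lemma sum_quarter_powers:
  fixes c g :: real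
  assumes "finite I" "\<And>i. i \<in> I \<Longrightarrow> c / 4 ^ i \<le> g" "c > 0" "g \<ge> 0"
  shows "(\<Sum>i\<in>I. 1 / 4 ^ i) \<le> 2 * g / c"
proof (cases "I = {}")
  case False
  \<comment> \<open>The coarsest scale \<open>m\<close> dominates the sum, and the hypothesis at
    \<open>m\<close> alone gives the bound.\<close>
  define m n where "m = Min I" and "n = Max I"
  have mI: "m \<in> I" "m \<le> n"
    using False assms(1) by (auto simp: m_def n_def)
  have tail: "(\<Sum>i=m..m + k. 1 / 4 ^ i) \<le> 2 / 4 ^ m - 1 / (4::real) ^ (m + k)" for k
  proof (induction k)
    case (Suc k)
    have "1 / 4 ^ (m + Suc k) = (1 / 4) * (1 / (4::real) ^ (m + k))"
      by simp
    moreover have "(\<Sum>i=m..m + Suc k. 1 / 4 ^ i) = (\<Sum>i=m..m + k. 1 / 4 ^ i) + 1 / (4::real) ^ (m + Suc k)"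
      by simp
    moreover have "0 \<le> 1 / (4::real) ^ (m + k)"
      by simp
    ultimately show ?case
      using Suc by linarith
  qed simp
  have "(\<Sum>i\<in>I. 1 / 4 ^ i) \<le> (\<Sum>i=m..n. 1 / (4::real) ^ i)"
    using assms(1) by (intro sum_mono2) (auto simp: m_def n_def)
  also have "\<dots> \<le> 2 / 4 ^ m - 1 / 4 ^ n"
    using tail[of "n - m"] mI(2) by simp
  also have "\<dots> \<le> 2 / 4 ^ m"
    by simp
  also have "\<dots> = 2 * (c / 4 ^ m) / c"
    using assms(3) by simp
  also have "\<dots> \<le> 2 * g / c"
    using assms(2)[OF mI(1)] assms(3) by (intro divide_right_mono) auto
  finally show ?thesis .
qed (use assms in simp)

text \<open>The minimum switches near \<open>j = i\<close>. Levels up to \<open>i\<close> are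
  bounded by the second entry and give \<open>12 / 2 ^ i\<close>; finer ones are bounded by the
  first and give \<open>56 / 2 ^ i\<close>.\<close>

lemma sum_level_min:
  assumes "i \<le> t"
  shows "(\<Sum>j\<le>t. 2 ^ j * min (56 / 4 ^ j) (6 / 4 ^ i)) \<le> (68 / 2 ^ i :: real)"
proof -
  let ?f = "\<lambda>j. 2 ^ j * min (56 / 4 ^ j) (6 / 4 ^ i) :: real"
  have low: "sum ?f {..n} \<le> 12 * 2 ^ n / 4 ^ i - 6 / 4 ^ i" for n
  proof (induction n)
    case (Suc n)
    have "?f (Suc n) \<le> 2 ^ Suc n * (6 / 4 ^ i)"
      by (intro mult_left_mono) auto
    moreover have "2 ^ Suc n * (6 / 4 ^ i) = 12 * 2 ^ n / (4 ^ i :: real)"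
      "12 * 2 ^ Suc n / 4 ^ i = 2 * (12 * 2 ^ n / (4 ^ i :: real))"
      by simp_all
    ultimately show ?case
      using Suc unfolding sum.atMost_Suc by linarith
  qed simp
  have "sum ?f {..t} \<le> 68 / 2 ^ i - 56 / 2 ^ t"
    using assms
  proof (induction t rule: dec_induct)
    case base
    have "12 * 2 ^ i / (4::real) ^ i = 12 / 2 ^ i"
      by (simp add: two_four)
    moreover have "68 / 2 ^ i - 56 / 2 ^ i = (12 / 2 ^ i :: real)" "0 \<le> (6 / 4 ^ i :: real)"
      by (simp_all flip: diff_divide_distrib)
    ultimately show ?case
      using low[of i] by linarith
  next
    case (step n)
    have "?f (Suc n) \<le> 2 ^ Suc n * (56 / 4 ^ Suc n)"
      by (intro mult_left_mono) auto
    also have "\<dots> = 28 / 2 ^ n"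
      by (simp add: two_four)
    finally show ?case
      using step by simp
  qed
  moreover have "0 \<le> (56 / 2 ^ t :: real)"
    by simp
  ultimately show ?thesis
    by linarith
qed

section \<open>Prices reached by exploration, and the cost of trades near the boundary\<close>

context trade_round
begin

text \<open>Level \<open>j\<close> has only \<open>56 * 4 ^ (t - j)\<close> indices, so a larger
  candidate set would be reached in part only; \<open>card_candidates\<close> excludes this at the
  levels that have to make progress.\<close>

definition visited :: "nat \<Rightarrow> real set" where
  "visited j = (\<lambda>k. sorted_list_of_set (Q j) ! k) ` {k. k < card (Q j) \<and> k < 56 * 4 ^ (t - j)}"

lemma visited_subset: "visited j \<subseteq> Q j"
proof
  fix p assume "p \<in> visited j"
  then obtain k where "k < card (Q j)" "p = sorted_list_of_set (Q j) ! k"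
    by (auto simp: visited_def)
  then have "p \<in> set (sorted_list_of_set (Q j))"
    by (simp only: nth_mem length_sorted_list_of_set)
  then show "p \<in> Q j"
    using finite_candidates by simp
qed

lemma finite_visited: "finite (visited j)"
  using visited_subset finite_candidates finite_subset by blast

lemma card_visited: "card (visited j) \<le> 56 * 4 ^ (t - j)"
proof -
  have "card (visited j) \<le> card {k. k < card (Q j) \<and> k < 56 * 4 ^ (t - j)}"
    unfolding visited_def by (intro card_image_le) auto
  also have "\<dots> \<le> card {..<56 * 4 ^ (t - j) :: nat}"
    by (intro card_mono) auto
  finally show ?thesis by simp
qed

lemma visited_eq:
  assumes "card (Q j) \<le> 56 * 4 ^ (t - j)"
  shows "visited j = Q j"
proof -
  have "visited j = set (sorted_list_of_set (Q j))"
    unfolding visited_def set_conv_nth length_sorted_list_of_set using assms by auto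
  then show ?thesis
    using finite_candidates by simp
qed

text \<open>Indices beyond the candidates post the default price 2, which is assumed to contribute
  nothing.\<close>

lemma sum_visited:
  assumes "f 2 = 0"
  shows "(\<Sum>k<56 * 4 ^ (t - j). f (if k < card (Q j) then sorted_list_of_set (Q j) ! k else 2)) = (sum f (visited j) :: real)"
proof -
  let ?K = "{k. k < card (Q j) \<and> k < 56 * 4 ^ (t - j)}"
  have "(\<Sum>k<56 * 4 ^ (t - j). f (if k < card (Q j) then sorted_list_of_set (Q j) ! k else 2))
      = (\<Sum>k\<in>?K. f (sorted_list_of_set (Q j) ! k))"
    using assms by (intro sum.mono_neutral_cong_right) auto
  also have "\<dots> = sum f (visited j)"
  proof -
    have "inj_on (\<lambda>k. sorted_list_of_set (Q j) ! k) ?K"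
      by (rule inj_onI) (auto simp: nth_eq_iff_index_eq)
    then show ?thesis
      unfolding visited_def by (simp add: sum.reindex)
  qed
  finally show ?thesis .
qed

abbreviation "trades p \<equiv> sv \<le> p \<and> p \<le> bv"

definition alert :: "nat set" where
  "alert = {i. (i, h i) \<in> Act}"

lemma alert_subset: "alert \<subseteq> {..t}"
  using active_truthD by (auto simp: alert_def)

lemma finite_alert: "finite alert"
  using alert_subset finite_subset by blast

text \<open>A bound on the harm that a trade at \<open>p\<close> does to the \<open>W\<close> part
  of the potential: only scales whose correct hypothesis is active but not sure of \<open>p\<close>
  lose.\<close>

definition boundary_loss :: "real \<Rightarrow> real" where
  "boundary_loss p = (\<Sum>i\<in>alert. if (i, h i) \<in> core l r p then 0 else 1 / (1000 * 2 ^ i))"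

definition core_gain :: "nat \<Rightarrow> real \<Rightarrow> real" where
  "core_gain i p = (if i \<in> alert \<and> (i, h i) \<in> core l r p then 1 / (3 * 2 ^ i) else 0)"

lemma sum_gain_W_explore:
  assumes none: "(\<exists>p. endorsed H t l r W p) = False"
  shows "(\<Sum>i\<le>T. gain_W p True i / 2 ^ i) \<ge> core_gain m p - boundary_loss p"
proof -
  have "core_gain m p - boundary_loss p
     = (\<Sum>i\<in>alert. (if i = m then core_gain m p else 0) - (if (i, h i) \<in> core l r p then 0 else 1 / (1000 * 2 ^ i)))"
    unfolding boundary_loss_def sum_subtractf using finite_alert by (simp add: core_gain_def)
  also have "\<dots> \<le> (\<Sum>i\<in>alert. gain_W p True i / 2 ^ i)"
  proof (intro sum_mono)
    fix i assume i: "i \<in> alert"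
    have "(if (i, h i) \<in> core l r p then 1 / 3 else - (1 / 1000)) \<le> gain_W p True i"
      using gain_W_explore_success[OF none, of i p] i by (simp add: alert_def)
    then have "(if (i, h i) \<in> core l r p then 1 / 3 else - (1 / 1000)) / 2 ^ i \<le> gain_W p True i / 2 ^ i"
      by (intro divide_right_mono) auto
    then show "(if i = m then core_gain m p else 0) - (if (i, h i) \<in> core l r p then 0 else 1 / (1000 * 2 ^ i))
        \<le> gain_W p True i / 2 ^ i"
      by (auto simp: core_gain_def split: if_splits elim!: order_trans[rotated])
  qed
  also have "\<dots> \<le> (\<Sum>i\<le>T. gain_W p True i / 2 ^ i)"
  proof (intro sum_mono2)
    fix i assume "i \<in> {..T} - alert"
    then show "0 \<le> gain_W p True i / 2 ^ i"
      using gain_W_explore_success[OF none, of i p] by (simp add: alert_def)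
  qed (use alert_subset t_le in auto)
  finally show ?thesis .
qed

lemma sum_gain_V_ge:
  assumes "trades p" "j \<le> T"
  shows "(\<Sum>i\<le>T. gain_V p True i / 2 ^ i) \<ge> gain_V p True j / 2 ^ j"
  using assms gain_V_nonneg by (intro member_le_sum) auto

text \<open>Such a price lies within \<open>2 / 4 ^ i\<close> of \<open>sv\<close> or
  \<open>bv\<close>: one tolerance for the prediction error and one for the margin in
  \<open>core\<close>.\<close>

lemma card_boundary:
  assumes "i \<le> t"
  shows "card {p \<in> price_grid t. trades p \<and> (i, h i) \<notin> core l r p} \<le> 6 * 4 ^ t / (4 ^ i :: real)"
proof -
  let ?d = "1 / 4 ^ i :: real"
  have le3: "real (card {p \<in> price_grid t. a \<le> p \<and> p \<le> a + 2 * ?d}) \<le> 3 * 4 ^ t / 4 ^ i" for a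
  proof -
    have "real (card {p \<in> price_grid t. a \<le> p \<and> p \<le> a + 2 * ?d}) \<le> 2 * 4 ^ t / 4 ^ i + 1"
      using card_price_grid_interval_le[of a "a + 2 * ?d" t] by simp
    also have "(1::real) \<le> 4 ^ t / 4 ^ i"
      using assms by (simp add: power_increasing)
    finally show ?thesis by simp
  qed
  have "{p \<in> price_grid t. trades p \<and> (i, h i) \<notin> core l r p}
      \<subseteq> {p \<in> price_grid t. sv \<le> p \<and> p \<le> sv + 2 * ?d} \<union> {p \<in> price_grid t. (bv - 2 * ?d) \<le> p \<and> p \<le> (bv - 2 * ?d) + 2 * ?d}"
    using l_close[of i] r_close[of i] by (auto simp: core_def not_le)
  then have "card {p \<in> price_grid t. trades p \<and> (i, h i) \<notin> core l r p}
      \<le> card {p \<in> price_grid t. sv \<le> p \<and> p \<le> sv + 2 * ?d} + card {p \<in> price_grid t. (bv - 2 * ?d) \<le> p \<and> p \<le> (bv - 2 * ?d) + 2 * ?d}"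
    by (rule order_trans[OF card_mono card_Un_le, rotated]) (simp add: finite_price_grid)
  then have "real (card {p \<in> price_grid t. trades p \<and> (i, h i) \<notin> core l r p})
      \<le> real (card {p \<in> price_grid t. sv \<le> p \<and> p \<le> sv + 2 * ?d}) + real (card {p \<in> price_grid t. (bv - 2 * ?d) \<le> p \<and> p \<le> (bv - 2 * ?d) + 2 * ?d})"
    by linarith
  then show ?thesis
    using le3[of sv] le3[of "bv - 2 * ?d"] by linarith
qed

text \<open>At level \<open>j\<close>, the harmful prices for scale \<open>i\<close> are limited
  both by the number of visited prices and by \<open>card_boundary\<close>. Summing over levels
  leaves \<open>68 / 2 ^ i\<close>, and summing over the active scales a multiple of the gap, since
  activity forces \<open>124 / 4 ^ i \<le> bv - sv\<close>. The constants fit because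
  \<open>68 / 1000 * 2 / 124 < 1 / 900\<close>.\<close>

lemma total_boundary_loss:
  "(\<Sum>j\<le>t. 2 ^ j * (\<Sum>p\<in>{p \<in> visited j. trades p}. boundary_loss p)) \<le> 4 ^ t * max 0 (bv - sv) / 900"
proof -
  have cnt: "real (card {p \<in> visited j. trades p \<and> (i, h i) \<notin> core l r p}) \<le> 4 ^ t * min (56 / 4 ^ j) (6 / 4 ^ i)"
    if "j \<le> t" "i \<in> alert" for i j
  proof -
    have "card {p \<in> visited j. trades p \<and> (i, h i) \<notin> core l r p} \<le> card (visited j)"
      using finite_visited by (intro card_mono) auto
    also have "\<dots> \<le> 56 * 4 ^ (t - j)"
      by (rule card_visited)
    finally have "real (card {p \<in> visited j. trades p \<and> (i, h i) \<notin> core l r p}) \<le> real (56 * 4 ^ (t - j))"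
      by (simp only: of_nat_le_iff)
    then have 1: "real (card {p \<in> visited j. trades p \<and> (i, h i) \<notin> core l r p}) \<le> 4 ^ t * (56 / 4 ^ j)"
      using power_four_diff[OF that(1)] by (simp add: mult.commute)
    have "card {p \<in> visited j. trades p \<and> (i, h i) \<notin> core l r p} \<le> card {p \<in> price_grid t. trades p \<and> (i, h i) \<notin> core l r p}"
      using visited_subset candidates_subset finite_price_grid by (intro card_mono) auto
    moreover have "i \<le> t"
      using that(2) alert_subset by auto
    ultimately have 2: "real (card {p \<in> visited j. trades p \<and> (i, h i) \<notin> core l r p}) \<le> 4 ^ t * (6 / 4 ^ i)"
      using card_boundary[of i] by (simp add: mult.commute)
    show ?thesis
      using 1 2 by (simp add: min_def)
  qed
  have "(\<Sum>j\<le>t. 2 ^ j * (\<Sum>p\<in>{p \<in> visited j. trades p}. boundary_loss p))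
      = (\<Sum>j\<le>t. \<Sum>i\<in>alert. 2 ^ j * (card {p \<in> visited j. trades p \<and> (i, h i) \<notin> core l r p} / (1000 * 2 ^ i)))"
  proof (intro sum.cong refl)
    fix j
    have "(\<Sum>p\<in>{p \<in> visited j. trades p}. boundary_loss p)
        = (\<Sum>i\<in>alert. \<Sum>p\<in>{p \<in> visited j. trades p}. if (i, h i) \<in> core l r p then 0 else 1 / (1000 * 2 ^ i))"
      unfolding boundary_loss_def by (rule sum.swap)
    also have "\<dots> = (\<Sum>i\<in>alert. card {p \<in> visited j. trades p \<and> (i, h i) \<notin> core l r p} / (1000 * 2 ^ i))"
    proof (intro sum.cong refl)
      fix i
      have "(\<Sum>p\<in>{p \<in> visited j. trades p}. if (i, h i) \<in> core l r p then 0 else 1 / (1000 * 2 ^ i :: real))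
          = (\<Sum>p\<in>{p \<in> visited j. trades p \<and> (i, h i) \<notin> core l r p}. 1 / (1000 * 2 ^ i))"
        using finite_visited by (intro sum.mono_neutral_cong_right) auto
      then show "(\<Sum>p\<in>{p \<in> visited j. trades p}. if (i, h i) \<in> core l r p then 0 else 1 / (1000 * 2 ^ i))
          = card {p \<in> visited j. trades p \<and> (i, h i) \<notin> core l r p} / (1000 * 2 ^ i)"
        by simp
    qed
    finally show "2 ^ j * (\<Sum>p\<in>{p \<in> visited j. trades p}. boundary_loss p)
        = (\<Sum>i\<in>alert. 2 ^ j * (card {p \<in> visited j. trades p \<and> (i, h i) \<notin> core l r p} / (1000 * 2 ^ i)))"
      by (simp add: sum_distrib_left)
  qed
  also have "\<dots> \<le> (\<Sum>j\<le>t. \<Sum>i\<in>alert. 2 ^ j * (4 ^ t * min (56 / 4 ^ j) (6 / 4 ^ i) / (1000 * 2 ^ i)))"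
    by (intro sum_mono mult_left_mono divide_right_mono cnt) auto
  also have "\<dots> = (\<Sum>i\<in>alert. 4 ^ t / (1000 * 2 ^ i) * (\<Sum>j\<le>t. 2 ^ j * min (56 / 4 ^ j) (6 / 4 ^ i)))"
    by (subst sum.swap) (simp add: sum_distrib_left mult_ac)
  also have "\<dots> \<le> (\<Sum>i\<in>alert. 4 ^ t / (1000 * 2 ^ i) * (68 / 2 ^ i))"
    using alert_subset by (intro sum_mono mult_left_mono sum_level_min) auto
  also have "\<dots> = 4 ^ t * 68 / 1000 * (\<Sum>i\<in>alert. 1 / 4 ^ i)"
    by (simp add: sum_distrib_left two_four mult_ac)
  also have "\<dots> \<le> 4 ^ t * 68 / 1000 * (2 * max 0 (bv - sv) / 124)"
  proof (intro mult_left_mono sum_quarter_powers finite_alert)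
    fix i assume "i \<in> alert"
    then show "124 / 4 ^ i \<le> max 0 (bv - sv)"
      using active_truthD(2)[of i] by (simp add: alert_def)
  qed auto
  also have "\<dots> \<le> 4 ^ t * max 0 (bv - sv) / 900"
  proof -
    have "(0::real) \<le> 4 ^ t * max 0 (bv - sv)"
      by simp
    then show ?thesis by (simp add: field_simps)
  qed
  finally show ?thesis .
qed

text \<open>The candidate sets decrease, so a trading grid price is either dropped at exactly one
  level up to \<open>n\<close> or survives them all.\<close>

lemma card_candidates_telescope:
  "(\<Sum>j\<le>n. real (card {p \<in> Q j. p \<notin> Q (Suc j) \<and> trades p}))
     = real (card {p \<in> price_grid t. trades p}) - real (card {p \<in> Q (Suc n). trades p})"
proof -
  have *: "real (card {p \<in> Q j. p \<notin> Q (Suc j) \<and> trades p})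
      = real (card {p \<in> Q j. trades p}) - real (card {p \<in> Q (Suc j). trades p})" for j
  proof -
    have "{p \<in> Q j. p \<notin> Q (Suc j) \<and> trades p} = {p \<in> Q j. trades p} - {p \<in> Q (Suc j). trades p}"
      by auto
    moreover have "{p \<in> Q (Suc j). trades p} \<subseteq> {p \<in> Q j. trades p}"
      by auto
    moreover have "finite {p \<in> Q j. trades p}"
      using finite_candidates by simp
    ultimately show ?thesis
      by (simp only: card_Diff_subset finite_subset card_mono of_nat_diff)
  qed
  show ?thesis
    unfolding * by (induction n) auto
qed

end

section \<open>Drop of the potential summed over the seeds of a round\<close>

context trade_round
begin

text \<open>A failed exploration changes no weight, so only trades contribute; the default price 2
  never trades.\<close>

lemma sum_decrease_explore:
  assumes none: "(\<exists>p. endorsed H t l r W p) = False"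
  shows "(\<Sum>u\<in>seeds t. decrease (post H t l r (W, V) u) (trades (post H t l r (W, V) u)))
    = (\<Sum>j\<le>t. 2 ^ j * (\<Sum>p\<in>{p \<in> visited j. trades p}. decrease p True))"
proof -
  define f where "f p = (if trades p then decrease p True else 0)" for p
  have f: "decrease p (trades p) = f p" for p
    by (simp add: f_def learn_def none)
  have f2: "f 2 = 0"
  proof -
    have "\<not> trades 2"
      using vals by linarith
    then show ?thesis
      unfolding f_def by (rule if_not_P)
  qed
  have post: "post H t l r (W, V) u
      = (if fst (snd u) < card (Q (fst u)) then sorted_list_of_set (Q (fst u)) ! fst (snd u) else 2)" for u
    by (simp add: post_def none split_def)
  have "(\<Sum>u\<in>seeds t. f (post H t l r (W, V) u))
     = (\<Sum>j\<le>t. 2 ^ j * (\<Sum>k<56 * 4 ^ (t - j). f (if k < card (Q j) then sorted_list_of_set (Q j) ! k else 2)))"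
    unfolding post by (rule sum_seeds)
  also have "\<dots> = (\<Sum>j\<le>t. 2 ^ j * sum f (visited j))"
    by (simp only: sum_visited[of f, OF f2])
  also have "\<dots> = (\<Sum>j\<le>t. 2 ^ j * (\<Sum>p\<in>{p \<in> visited j. trades p}. decrease p True))"
    using finite_visited by (intro sum.cong refl arg_cong2[of _ _ _ _ "(*)"] sum.mono_neutral_cong_right) (auto simp: f_def)
  finally show ?thesis
    by (simp only: f)
qed

lemma decrease_explore_ge:
  assumes none: "(\<exists>p. endorsed H t l r W p) = False" and "trades p" "j \<le> T"
  shows "decrease p True \<ge> gain_V p True j / 2 ^ j + core_gain m p - boundary_loss p"
  using sum_gain_W_explore[OF none, of m p] sum_gain_V_ge[OF assms(2,3)] unfolding decrease_eq by linarith

text \<open>A bound for every gap: of the three terms in \<open>decrease_explore_ge\<close> only the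
  boundary loss counts against progress.\<close>

lemma explore_drift_ge:
  assumes none: "(\<exists>p. endorsed H t l r W p) = False"
  shows "(\<Sum>u\<in>seeds t. decrease (post H t l r (W, V) u) (trades (post H t l r (W, V) u)))
    \<ge> - (4 ^ t * max 0 (bv - sv) / 900)"
proof -
  have "- (4 ^ t * max 0 (bv - sv) / 900) \<le> - (\<Sum>j\<le>t. 2 ^ j * (\<Sum>p\<in>{p \<in> visited j. trades p}. boundary_loss p))"
    using total_boundary_loss by simp
  also have "\<dots> = (\<Sum>j\<le>t. 2 ^ j * (\<Sum>p\<in>{p \<in> visited j. trades p}. - boundary_loss p))"
    by (simp add: sum_negf)
  also have "\<dots> \<le> (\<Sum>j\<le>t. 2 ^ j * (\<Sum>p\<in>{p \<in> visited j. trades p}. decrease p True))"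
  proof (intro sum_mono mult_left_mono)
    fix j p assume "p \<in> {p \<in> visited j. trades p}"
    then have p: "trades p" by simp
    have "gain_V p True 0 / 2 ^ 0 \<ge> 0" "core_gain 0 p \<ge> 0"
      using gain_V_nonneg[of True p 0] p by (simp_all add: core_gain_def)
    then show "- boundary_loss p \<le> decrease p True"
      using decrease_explore_ge[OF none p, of 0 0] by linarith
  qed simp
  finally show ?thesis
    unfolding sum_decrease_explore[OF none] .
qed

text \<open>
  The scales that matter in a round: up to \<open>n\<close> the gap is below the resolution, and at \<open>m\<close>, which is only
  boundedly finer, the correct hypothesis is active.
\<close>

lemma truth_scale:
  assumes "128 / 4 ^ t \<le> bv - sv"
  obtains n m where "n < t" "\<And>j. j \<le> n \<Longrightarrow> bv - sv \<le> 2 / 4 ^ j" "m \<le> t" "m \<le> n + 4" "128 / 4 ^ m \<le> bv - sv"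
proof -
  define P where "P j \<longleftrightarrow> 2 / 4 ^ j < bv - sv" for j :: nat
  have "(2::real) / 4 ^ t < 128 / 4 ^ t"
    by (simp add: divide_strict_right_mono)
  then have "P t"
    using assms by (simp add: P_def)
  moreover have "\<not> P 0"
    using vals by (simp add: P_def)
  ultimately obtain n where n: "n < t" "\<forall>j\<le>n. \<not> P j" "P (Suc n)"
    using ex_least_nat_less[of P t] by blast
  show ?thesis
  proof (rule that)
    show "n < t" "min (n + 4) t \<le> t" "min (n + 4) t \<le> n + 4"
      using n(1) by auto
    show "bv - sv \<le> 2 / 4 ^ j" if "j \<le> n" for j
      using n(2) that by (simp add: P_def not_less)
    \<comment> \<open>The offset 4 is the least one with which \<open>P (Suc n)\<close> yields the
      required gap, as \<open>128 = 2 * 4 ^ 3\<close>.\<close>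
    have "128 / 4 ^ (n + 4) = (2 / 4 ^ Suc n :: real)"
      by (simp add: power_add)
    then show "128 / 4 ^ min (n + 4) t \<le> bv - sv"
      using assms n(3) by (auto simp: min_def P_def)
  qed
qed

text \<open>Every trading grid price makes progress. If it is dropped at a level up to
  \<open>n\<close>, a trade at it raises the weight in \<open>V\<close>; if it survives to level
  \<open>Suc n\<close>, it is usually in the core at scale \<open>m\<close>, and a trade raises the
  weight in \<open>W\<close>.\<close>

lemma explore_drift_large:
  assumes none: "(\<exists>p. endorsed H t l r W p) = False" and large: "128 / 4 ^ t \<le> bv - sv"
  shows "(\<Sum>u\<in>seeds t. decrease (post H t l r (W, V) u) (trades (post H t l r (W, V) u)))
    \<ge> 4 ^ t * (bv - sv) / 30"
proof -
  obtain n m where n: "n < t" "\<And>j. j \<le> n \<Longrightarrow> bv - sv \<le> 2 / 4 ^ j"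
    and m: "m \<le> t" "m \<le> n + 4" "128 / 4 ^ m \<le> bv - sv"
    using truth_scale[OF large] by metis
  define G where "G = 4 ^ t * (bv - sv)"
  have "0 < (128 / 4 ^ t :: real)"
    by simp
  then have g_pos: "bv - sv > 0"
    using large by linarith
  have G: "G \<ge> 128"
    using large by (simp add: G_def field_simps)
  have m_alert: "m \<in> alert"
    using active_truthI[OF m(1,3)] by (simp add: alert_def)
  have vis: "visited j = Q j" if "j \<le> Suc n" for j
  proof (intro visited_eq card_candidates)
    show "j \<le> t"
      using that n(1) by simp
    show "j = 0 \<or> h (j - 1) \<in> Aw (j - 1)"
      using awake_truthI[OF n(2)] that by (cases j) auto
  qed
  let ?drop = "\<lambda>j. {p \<in> Q j. p \<notin> Q (Suc j) \<and> trades p}"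
  let ?hit = "{p \<in> Q (Suc n). trades p \<and> (m, h m) \<in> core l r p}"
  \<comment> \<open>In \<open>a\<close> the \<open>2 ^ j\<close> copies of a seed cancel the factor
    \<open>1 / 2 ^ j\<close> of the potential. In \<open>b\<close> level \<open>Suc n\<close> is
    credited at scale \<open>m\<close>, so that \<open>2 ^ Suc n / 2 ^ m \<ge> 1 / 8\<close>
    remains.\<close>
  define a where "a j = (if j \<le> n then real (card (?drop j)) / 4 else 0)" for j
  define b where "b j = (if j = Suc n then 2 ^ Suc n * (real (card ?hit) / (3 * 2 ^ m)) else 0)" for j
  have "a j + b j - 2 ^ j * (\<Sum>p\<in>{p \<in> visited j. trades p}. boundary_loss p)
      \<le> 2 ^ j * (\<Sum>p\<in>{p \<in> visited j. trades p}. decrease p True)" if j: "j \<le> t" for j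
  proof -
    have fin: "finite {p \<in> visited j. trades p}"
      using finite_visited by simp
    have "a j \<le> 2 ^ j * (\<Sum>p\<in>{p \<in> visited j. trades p}. gain_V p True j / 2 ^ j)"
    proof (cases "j \<le> n")
      case True
      have "real (card (?drop j)) / 4 = (\<Sum>p\<in>?drop j. 1 / 4)"
        by simp
      also have "\<dots> \<le> (\<Sum>p\<in>?drop j. gain_V p True j)"
        using True by (intro sum_mono gain_V_candidate awake_truthI n(2)) auto
      also have "\<dots> \<le> (\<Sum>p\<in>{p \<in> visited j. trades p}. gain_V p True j)"
        using True fin by (intro sum_mono2 gain_V_nonneg) (auto simp: vis)
      finally show ?thesis
        using True by (simp add: a_def sum_divide_distrib[symmetric])
    next
      case False
      then show ?thesis
        by (auto simp: a_def intro!: mult_nonneg_nonneg sum_nonneg divide_nonneg_nonneg gain_V_nonneg)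
    qed
    moreover have "b j \<le> 2 ^ j * (\<Sum>p\<in>{p \<in> visited j. trades p}. core_gain m p)"
    proof (cases "j = Suc n")
      case True
      have "real (card ?hit) / (3 * 2 ^ m) = (\<Sum>p\<in>?hit. core_gain m p)"
        using m_alert by (simp add: core_gain_def)
      also have "\<dots> \<le> (\<Sum>p\<in>{p \<in> visited j. trades p}. core_gain m p)"
        using True fin by (intro sum_mono2) (auto simp: vis core_gain_def)
      finally have "2 ^ j * (real (card ?hit) / (3 * 2 ^ m)) \<le> 2 ^ j * (\<Sum>p\<in>{p \<in> visited j. trades p}. core_gain m p)"
        by (rule mult_left_mono) simp
      then show ?thesis
        unfolding b_def using True by simp
    next
      case False
      then show ?thesis
        by (auto simp: b_def core_gain_def intro!: mult_nonneg_nonneg sum_nonneg)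
    qed
    moreover have "(\<Sum>p\<in>{p \<in> visited j. trades p}. gain_V p True j / 2 ^ j + core_gain m p - boundary_loss p)
        \<le> (\<Sum>p\<in>{p \<in> visited j. trades p}. decrease p True)"
      using j t_le by (intro sum_mono decrease_explore_ge none) auto
    then have "2 ^ j * ((\<Sum>p\<in>{p \<in> visited j. trades p}. gain_V p True j / 2 ^ j)
        + (\<Sum>p\<in>{p \<in> visited j. trades p}. core_gain m p) - (\<Sum>p\<in>{p \<in> visited j. trades p}. boundary_loss p))
        \<le> 2 ^ j * (\<Sum>p\<in>{p \<in> visited j. trades p}. decrease p True)"
      by (intro mult_left_mono) (simp_all add: sum.distrib sum_subtractf)
    ultimately show ?thesis
      unfolding distrib_left right_diff_distrib by linarith
  qed
  then have "(\<Sum>j\<le>t. a j + b j - 2 ^ j * (\<Sum>p\<in>{p \<in> visited j. trades p}. boundary_loss p))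
      \<le> (\<Sum>j\<le>t. 2 ^ j * (\<Sum>p\<in>{p \<in> visited j. trades p}. decrease p True))"
    by (intro sum_mono) auto
  moreover have "(\<Sum>j\<le>t. a j + b j - 2 ^ j * (\<Sum>p\<in>{p \<in> visited j. trades p}. boundary_loss p))
      = sum a {..t} + sum b {..t} - (\<Sum>j\<le>t. 2 ^ j * (\<Sum>p\<in>{p \<in> visited j. trades p}. boundary_loss p))"
    by (simp add: sum.distrib sum_subtractf)
  moreover have "(\<Sum>j\<le>t. 2 ^ j * (\<Sum>p\<in>{p \<in> visited j. trades p}. boundary_loss p)) \<le> G / 900"
    using total_boundary_loss g_pos by (simp add: G_def)
  ultimately have main: "sum a {..t} + sum b {..t} - G / 900
      \<le> (\<Sum>u\<in>seeds t. decrease (post H t l r (W, V) u) (trades (post H t l r (W, V) u)))"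
    unfolding sum_decrease_explore[OF none] by linarith
  have "sum a {..t} = (\<Sum>j\<le>n. real (card (?drop j)) / 4)"
    using n(1) by (intro sum.mono_neutral_cong_right) (auto simp: a_def)
  also have "\<dots> = (real (card {p \<in> price_grid t. trades p}) - real (card {p \<in> Q (Suc n). trades p})) / 4"
    by (simp only: sum_divide_distrib[symmetric] card_candidates_telescope)
  finally have a_eq: "sum a {..t} = (real (card {p \<in> price_grid t. trades p}) - real (card {p \<in> Q (Suc n). trades p})) / 4" .
  have sub: "real (card {p \<in> Q (Suc n). trades p}) \<le> real (card {p \<in> price_grid t. trades p})"
    using candidates_subset finite_price_grid by (intro of_nat_mono card_mono) auto
  have tot: "real (card {p \<in> price_grid t. trades p}) \<ge> G - 1"
    using card_price_grid_interval_ge[of sv bv t] vals by (simp add: G_def mult.commute abs_le_iff)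
  have hit: "real (card ?hit) \<ge> real (card {p \<in> Q (Suc n). trades p}) - 6 * G / 128"
  proof -
    let ?B = "{p \<in> price_grid t. trades p \<and> (m, h m) \<notin> core l r p}"
    have "{p \<in> Q (Suc n). trades p} \<subseteq> ?hit \<union> ?B"
      using candidates_subset[of "Suc n"] by blast
    then have "card {p \<in> Q (Suc n). trades p} \<le> card ?hit + card ?B"
      using finite_candidates[of "Suc n"] finite_price_grid[of t]
      by (intro order_trans[OF card_mono card_Un_le]) (simp_all del: candidates.simps)
    then have "real (card {p \<in> Q (Suc n). trades p}) \<le> real (card ?hit) + real (card ?B)"
      by linarith
    moreover have "real (card ?B) \<le> 6 * 4 ^ t / 4 ^ m"
      by (rule card_boundary[OF m(1)])
    moreover have "6 * 4 ^ t / 4 ^ m \<le> 6 * G / 128"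
      using mult_left_mono[OF m(3), of "6 * 4 ^ t / 128"] by (simp add: G_def mult_ac)
    ultimately show ?thesis by linarith
  qed
  have "sum b {..t} = 2 ^ Suc n / 2 ^ m * real (card ?hit) / 3"
    using n(1) by (simp add: b_def)
  also have "\<dots> \<ge> 1 / 8 * real (card ?hit) / 3"
  proof -
    have "(2::real) ^ m \<le> 2 ^ (n + 4)"
      using m(2) by (intro power_increasing) auto
    then have "(1::real) / 8 \<le> 2 ^ Suc n / 2 ^ m"
      by (simp add: field_simps power_add)
    then show ?thesis
      by (intro divide_right_mono mult_right_mono) auto
  qed
  finally have "sum b {..t} \<ge> real (card ?hit) / 24"
    by simp
  \<comment> \<open>Each trading price is worth at least \<open>1 / 24\<close>, except for at most
    \<open>6 * G / 128\<close> boundary prices; \<open>G \<ge> 128\<close> absorbs the missing 1 in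
    \<open>G - 1\<close>.\<close>
  moreover have "G / 30 \<le> x"
    if "c2 / 24 \<le> sb" "sa + sb - G / 900 \<le> x" "sa = (c1 - c0) / 4" "c0 \<le> c1" "G - 1 \<le> c1" "c0 - 6 * G / 128 \<le> c2"
    for sa sb c0 c1 c2 x
    using that G by (simp add: field_simps)
  ultimately show ?thesis
    using main a_eq sub tot hit unfolding G_def[symmetric] by blast
qed

text \<open>A failure costs at most
  \<open>2 / 4 ^ n \<le> 32 / 2 ^ (n + 4) \<le> 32 / 2 ^ m\<close>, and the active scale
  \<open>m\<close> alone lowers the potential by \<open>1 / (2000 * 2 ^ m)\<close>, whence
  \<open>64000 = 32 * 2000\<close>. Gaps below \<open>128 / 4 ^ t\<close> go into the additive
  term.\<close>

lemma commit_drift: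
  assumes "endorsed H t l r W p"
  shows "(if trades p then 0 else max 0 (bv - sv)) \<le> 64000 * decrease p (trades p) + 300 / 4 ^ t"
proof (cases "trades p")
  case True
  have "gain_W p True i = 0" for i
    using assms by (auto simp: gain_W_def learn_def)
  then have "decrease p True \<ge> 0"
    unfolding decrease_eq using gain_V_nonneg[of True p] True by (simp add: sum_nonneg)
  then show ?thesis
    using True by simp
next
  case False
  have gV: "(\<Sum>i\<le>T. gain_V p False i / 2 ^ i) \<ge> 0"
    using gain_V_nonneg[of False p] by (simp add: sum_nonneg)
  have gW: "gain_W p False i \<ge> 0" for i
    using gain_W_commit_fail[OF assms False, of i] by (auto split: if_splits)
  show ?thesis
  proof (cases "128 / 4 ^ t \<le> bv - sv")
    case large: True
    obtain n m where n: "n < t" "\<And>j. j \<le> n \<Longrightarrow> bv - sv \<le> 2 / 4 ^ j"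
      and m: "m \<le> t" "m \<le> n + 4" "128 / 4 ^ m \<le> bv - sv"
      using truth_scale[OF large] by metis
    have "(bv - sv) / 64000 \<le> (2 / 4 ^ n) / 64000"
      using n(2)[of n] by (intro divide_right_mono) auto
    also have "\<dots> \<le> (2 / 2 ^ n) / 64000"
      by (intro divide_right_mono divide_left_mono power_mono) auto
    also have "\<dots> = (1 / 2000) / 2 ^ (n + 4)"
      by (simp add: power_add)
    also have "\<dots> \<le> (1 / 2000) / 2 ^ m"
      using m(2) by (intro divide_left_mono power_increasing) auto
    also have "\<dots> \<le> gain_W p False m / 2 ^ m"
      using gain_W_commit_fail[OF assms False, of m] active_truthI[OF m(1,3)] by (intro divide_right_mono) auto
    also have "\<dots> \<le> (\<Sum>i\<le>T. gain_W p False i / 2 ^ i)"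
      using gW m(1) t_le by (intro member_le_sum) auto
    finally have "(bv - sv) / 64000 \<le> decrease p False"
      unfolding decrease_eq using gV by linarith
    then have "bv - sv \<le> 64000 * decrease p False"
      by simp
    moreover have "0 < (128 / 4 ^ t :: real)" "0 \<le> (300 / 4 ^ t :: real)"
      by simp_all
    moreover from this have "max 0 (bv - sv) = bv - sv"
      using large by linarith
    ultimately show ?thesis
      using False by (simp only: if_False)
  next
    case small: False
    have d: "decrease p False \<ge> 0"
      unfolding decrease_eq using gV gW by (simp add: sum_nonneg add_nonneg_nonneg)
    have b1: "128 / 4 ^ t \<le> (300 / 4 ^ t :: real)"
      by (simp add: divide_right_mono)
    have b2: "max 0 (bv - sv) \<le> 128 / 4 ^ t"
      using small by simp
    have arith: "y \<le> 64000 * x + z" if "0 \<le> x" "w \<le> z" "y \<le> w" for x y z w :: real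
      using that by linarith
    have tr: "trades p = False"
      using False by blast
    show ?thesis
      unfolding tr if_False by (rule arith[OF d b1 b2])
  qed
qed

text \<open>When exploring, the whole gap is charged to every seed. A large gap costs at most
  \<open>112 * 4 ^ t\<close> times itself, far less than \<open>64000 / 30 * 4 ^ t\<close> times.
  For a small gap the drift may be negative, and \<open>128 * (1 + 64000 / (900 * 56)) < 300\<close>
  covers both the charge and the drift.\<close>

lemma round_drift:
  "(\<Sum>u\<in>seeds t. if trades (post H t l r (W, V) u) then 0 else max 0 (bv - sv))
    \<le> (\<Sum>u\<in>seeds t. 64000 * decrease (post H t l r (W, V) u) (trades (post H t l r (W, V) u)) + 300 / 4 ^ t)"
proof (cases "\<exists>p. endorsed H t l r W p")
  case True
  have "endorsed H t l r W (post H t l r (W, V) u)" for u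
    using True someI_ex[OF True] by (simp add: post_def split_def)
  then show ?thesis
    by (intro sum_mono commit_drift)
next
  case False
  then have none: "(\<exists>p. endorsed H t l r W p) = False"
    by simp
  define g where "g = max 0 (bv - sv)"
  define D where "D = (\<Sum>u\<in>seeds t. decrease (post H t l r (W, V) u) (trades (post H t l r (W, V) u)))"
  let ?N = "real (card (seeds t))"
  have g0: "g \<ge> 0"
    by (simp add: g_def)
  have "(\<Sum>u\<in>seeds t. if trades (post H t l r (W, V) u) then 0 else max 0 (bv - sv)) \<le> (\<Sum>u\<in>seeds t. g)"
    by (intro sum_mono) (auto simp: g_def)
  also have "\<dots> = ?N * g"
    by simp
  also have "\<dots> \<le> 64000 * D + ?N * (300 / 4 ^ t)"
  proof (cases "128 / 4 ^ t \<le> bv - sv")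
    case True
    have "0 < (128 / 4 ^ t :: real)"
      by simp
    then have "g = bv - sv"
      using True unfolding g_def by linarith
    then have "D \<ge> 4 ^ t * g / 30"
      using explore_drift_large[OF none True] by (simp add: D_def)
    moreover have "?N * g \<le> (112 * 4 ^ t) * g"
      by (intro mult_right_mono card_seeds g0)
    moreover have "0 \<le> 4 ^ t * g" "0 \<le> ?N * (300 / 4 ^ t)"
      using g0 by simp_all
    ultimately show ?thesis
      by linarith
  next
    case False
    have "g \<le> 128 / 4 ^ t"
      using False unfolding g_def by (simp add: not_le less_imp_le)
    then have "?N * g \<le> ?N * (128 / 4 ^ t)"
      by (intro mult_left_mono) auto
    moreover have "D \<ge> - (4 ^ t * g / 900)"
      using explore_drift_ge[OF none] by (simp add: D_def g_def)
    moreover have "(56 * 4 ^ t) * g \<le> ?N * g"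
      by (intro mult_right_mono card_seeds g0)
    moreover have "?N * (300 / 4 ^ t) = 300 * (?N / 4 ^ t)" "?N * (128 / 4 ^ t) = 128 * (?N / 4 ^ t)"
      by simp_all
    moreover have "?N / 4 ^ t \<ge> 0"
      by simp
    ultimately show ?thesis
      by linarith
  qed
  also have "\<dots> = (\<Sum>u\<in>seeds t. 64000 * decrease (post H t l r (W, V) u) (trades (post H t l r (W, V) u)) + 300 / 4 ^ t)"
    unfolding D_def sum.distrib by (simp only: sum_distrib_left sum_constant)
  finally show ?thesis .
qed

end

section \<open>Nets of hypotheses\<close>

text \<open>The invariant of the weights: mass at most 1 keeps every weight in the potential at most
  1, so the potential stays nonnegative.\<close>

definition admissible :: "(nat \<Rightarrow> 'h set) \<Rightarrow> nat \<Rightarrow> 'h weights \<Rightarrow> bool" where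
  "admissible H T = (\<lambda>(W, V). (\<forall>i. \<forall>a\<in>H i. W (i, a) > 0 \<and> V i a > 0) \<and>
     sum W (Sigma {..T} H) \<le> 1 \<and> (\<forall>i. sum (V i) (H i) \<le> 1))"

lemma admissible_learn:
  assumes "admissible H T \<sigma>" "t \<le> T" "\<And>i. finite (H i)"
  shows "admissible H T (learn H t l r \<sigma> p y)"
proof -
  obtain W V where \<sigma>: "\<sigma> = (W, V)"
    by (cases \<sigma>)
  have pos: "W (i, a) > 0" "V i a > 0" if "a \<in> H i" for i a
    using assms(1) that by (auto simp: admissible_def \<sigma>)
  have act: "active H t l r \<subseteq> Sigma {..T} H"
    using assms(2) by (auto simp: active_def)
  have fin: "finite (active H t l r)"
    by (rule finite_subset[OF act]) (use assms(3) in auto)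
  have act_pos: "W e > 0" if "e \<in> active H t l r" for e
    using that pos by (auto simp: active_def)
  have aw: "awake H l r j \<subseteq> H j" for j
    by (auto simp: awake_def)
  have aw_pos: "V j a > 0" if "a \<in> awake H l r j" for j a
    using that pos aw by blast
  have fin_aw: "finite (awake H l r j)" for j
    using aw assms(3) finite_subset by blast
  have W': "boost W (active H t l r) F (i, a) > 0" if "a \<in> H i" for F i a
    using fin act_pos pos(1)[OF that] by (rule boost_pos)
  have V': "boost (V i) (awake H l r i) F a > 0" if "a \<in> H i" for F i a
    using fin_aw aw_pos pos(2)[OF that] by (rule boost_pos)
  have sW: "sum (boost W (active H t l r) F) (Sigma {..T} H) = sum W (Sigma {..T} H)" for F
    by (rule sum_boost[OF _ act act_pos]) (use assms(3) in auto)
  have sV: "sum (boost (V i) (awake H l r i) F) (H i) = sum (V i) (H i)" for F i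
    by (rule sum_boost[OF assms(3) aw aw_pos])
  show ?thesis
    using assms(1) pos W' V' by (auto simp: admissible_def \<sigma> learn_def sW sV)
qed

lemma potential_nonneg:
  assumes "admissible H T \<sigma>" "\<And>i. finite (H i)" "\<And>i. h i \<in> H i"
  shows "potential T h \<sigma> \<ge> 0"
proof -
  obtain W V where \<sigma>: "\<sigma> = (W, V)"
    by (cases \<sigma>)
  have pos: "W (i, a) > 0" "V i a > 0" if "a \<in> H i" for i a
    using assms(1) that by (auto simp: admissible_def \<sigma>)
  have "- ln (W (i, h i)) - ln (V i (h i)) \<ge> 0" if "i \<le> T" for i
  proof -
    have "W (i, h i) \<le> sum W (Sigma {..T} H)"
      using that assms(2,3) by (intro member_le_sum) (auto intro: less_imp_le pos)
    then have "W (i, h i) \<le> 1"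
      using assms(1) by (simp add: admissible_def \<sigma>)
    then have "ln (W (i, h i)) \<le> 0"
      using pos(1)[OF assms(3)] by simp
    moreover have "V i (h i) \<le> sum (V i) (H i)"
      using assms(2,3) by (intro member_le_sum) (auto intro: less_imp_le pos)
    then have "V i (h i) \<le> 1"
      using assms(1) by (auto simp: admissible_def \<sigma> intro: order_trans)
    then have "ln (V i (h i)) \<le> 0"
      using pos(2)[OF assms(3)] by simp
    ultimately show ?thesis by simp
  qed
  then show ?thesis
    by (auto simp: potential_def \<sigma> intro!: sum_nonneg)
qed

text \<open>
  The spacing \<open>1 / (d 4\<^sup>i)\<close> per coordinate gives error at most \<open>4\<^sup>-\<^sup>i\<close> on inner products with
  unit vectors.
\<close>

definition net :: "nat \<Rightarrow> nat \<Rightarrow> vec set" where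
  "net d i = (\<Pi>\<^sub>E _\<in>{..<d}. (\<lambda>k::int. k / real (d * 4 ^ i)) ` {- int (d * 4 ^ i)..int (d * 4 ^ i)})"

definition hyps :: "nat \<Rightarrow> nat \<Rightarrow> (vec \<times> vec) set" where
  "hyps d i = net d i \<times> net d i"

lemma finite_hyps: "finite (hyps d i)"
  by (auto simp: hyps_def net_def intro!: finite_PiE)

lemma card_hyps_le: "card (hyps d i) \<le> (2 * (d * 4 ^ i) + 1) ^ (2 * d)"
proof -
  have "card (net d i) = (\<Prod>_<d. card ((\<lambda>k::int. k / real (d * 4 ^ i)) ` {- int (d * 4 ^ i)..int (d * 4 ^ i)}))"
    unfolding net_def by (rule card_PiE) simp
  also have "\<dots> \<le> (\<Prod>_<d. 2 * (d * 4 ^ i) + 1)"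
  proof (intro prod_mono conjI)
    fix k :: nat
    have "card ((\<lambda>k::int. k / real (d * 4 ^ i)) ` {- int (d * 4 ^ i)..int (d * 4 ^ i)}) \<le> card {- int (d * 4 ^ i)..int (d * 4 ^ i)}"
      by (rule card_image_le) simp
    moreover have "card {- int n..int n} = 2 * n + 1" for n :: nat
      by simp
    ultimately show "card ((\<lambda>k::int. k / real (d * 4 ^ i)) ` {- int (d * 4 ^ i)..int (d * 4 ^ i)}) \<le> 2 * (d * 4 ^ i) + 1"
      by (simp only:)
  qed simp
  finally have "card (net d i) \<le> (2 * (d * 4 ^ i) + 1) ^ d"
    by simp
  then have "card (net d i) * card (net d i) \<le> (2 * (d * 4 ^ i) + 1) ^ d * (2 * (d * 4 ^ i) + 1) ^ d"
    by (intro mult_mono) auto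
  then show ?thesis
    by (simp add: hyps_def card_cartesian_product mult_2 power_add)
qed

lemma unit_ball_coord:
  assumes "in_unit_ball d v" "k < d"
  shows "\<bar>v k\<bar> \<le> 1"
proof -
  have "(v k)\<^sup>2 \<le> (\<Sum>i<d. (v i)\<^sup>2)"
    using assms(2) by (intro member_le_sum) auto
  also have "\<dots> \<le> 1"
    using assms(1) by (simp add: in_unit_ball_def)
  finally show ?thesis
    by (simp add: abs_square_le_1)
qed

lemma unit_ball_inner:
  assumes "in_unit_ball d u" "in_unit_ball d v"
  shows "\<bar>inner_d d u v\<bar> \<le> 1"
proof -
  have "(inner_d d u v)\<^sup>2 \<le> (\<Sum>i<d. (u i)\<^sup>2) * (\<Sum>i<d. (v i)\<^sup>2)"
    unfolding inner_d_def by (rule Cauchy_Schwarz_ineq_sum)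
  also have "\<dots> \<le> 1 * 1"
    using assms by (intro mult_mono) (auto simp: in_unit_ball_def sum_nonneg)
  finally show ?thesis
    by (simp add: abs_square_le_1)
qed

lemma net_approx:
  assumes "in_unit_ball d v" "d \<ge> 1"
  obtains w where "w \<in> net d i" "\<And>x. in_unit_ball d x \<Longrightarrow> \<bar>inner_d d w x - inner_d d v x\<bar> \<le> 1 / 4 ^ i"
proof -
  define N where "N = d * 4 ^ i"
  have N: "N > 0"
    using assms(2) by (simp add: N_def)
  define w where "w = (\<lambda>k\<in>{..<d}. \<lfloor>v k * N\<rfloor> / real N)"
  have "w \<in> net d i"
    unfolding net_def N_def[symmetric]
  proof (rule PiE_I)
    fix k assume k: "k \<in> {..<d}"
    have "\<bar>v k * N\<bar> \<le> real N"
      using unit_ball_coord[OF assms(1), of k] k by (simp add: abs_mult mult_left_le_one_le)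
    then have "- real N \<le> v k * N" "v k * N \<le> real N"
      by linarith+
    then have "\<lfloor>v k * N\<rfloor> \<in> {- int N..int N}"
      by (simp add: le_floor_iff floor_le_iff)
    then show "w k \<in> (\<lambda>k::int. k / real N) ` {- int N..int N}"
      using k by (auto simp: w_def)
  qed (simp add: w_def)
  moreover have "\<bar>inner_d d w x - inner_d d v x\<bar> \<le> 1 / 4 ^ i" if x: "in_unit_ball d x" for x
  proof -
    have "\<bar>inner_d d w x - inner_d d v x\<bar> = \<bar>\<Sum>k<d. (w k - v k) * x k\<bar>"
      by (simp add: inner_d_def sum_subtractf left_diff_distrib)
    also have "\<dots> \<le> (\<Sum>k<d. \<bar>(w k - v k) * x k\<bar>)"
      by (rule sum_abs)
    also have "\<dots> \<le> (\<Sum>k<d. 1 / real N)"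
    proof (intro sum_mono)
      fix k assume k: "k \<in> {..<d}"
      have "w k - v k = (\<lfloor>v k * N\<rfloor> - v k * N) / N"
        using k N by (simp add: w_def diff_divide_distrib)
      moreover have "\<bar>\<lfloor>v k * N\<rfloor> - v k * N\<bar> \<le> 1"
        by linarith
      ultimately have "\<bar>w k - v k\<bar> \<le> 1 / real N"
        using N by (simp add: divide_right_mono)
      moreover have "\<bar>x k\<bar> \<le> 1"
        using unit_ball_coord[OF x] k by simp
      ultimately have "\<bar>w k - v k\<bar> * \<bar>x k\<bar> \<le> 1 / real N * 1"
        by (intro mult_mono) auto
      then show "\<bar>(w k - v k) * x k\<bar> \<le> 1 / real N"
        by (simp add: abs_mult)
    qed
    also have "\<dots> = 1 / 4 ^ i"
      using assms(2) by (simp add: N_def)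
    finally show ?thesis .
  qed
  ultimately show ?thesis
    by (rule that)
qed

text \<open>The factor \<open>1 / 2 ^ Suc i\<close> keeps the joint mass of all scales below 1 for
  every horizon, so the policy does not have to know \<open>T\<close>.\<close>

definition initial :: "nat \<Rightarrow> (vec \<times> vec) weights" where
  "initial d = (\<lambda>(i, a). 1 / (2 ^ Suc i * card (hyps d i)), \<lambda>i a. 1 / card (hyps d i))"

lemma hyps_nonempty: "d \<ge> 1 \<Longrightarrow> card (hyps d i) > 0"
proof -
  assume d: "d \<ge> 1"
  have "in_unit_ball d (\<lambda>_. 0)"
    by (simp add: in_unit_ball_def)
  then obtain w where "w \<in> net d i"
    using net_approx[OF _ d] by metis
  then show ?thesis
    using finite_hyps[of d i] by (auto simp: card_gt_0_iff hyps_def)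
qed

lemma admissible_initial:
  assumes "d \<ge> 1"
  shows "admissible (hyps d) T (initial d)"
proof -
  have "(\<Sum>e\<in>Sigma {..T} (hyps d). fst (initial d) e) = (\<Sum>i\<le>T. \<Sum>a\<in>hyps d i. fst (initial d) (i, a))"
    using finite_hyps by (subst sum.Sigma) auto
  also have "\<dots> = (\<Sum>i\<le>T. 1 / 2 ^ Suc i)"
    using hyps_nonempty[OF assms] by (intro sum.cong) (auto simp: initial_def)
  also have "\<dots> = (\<Sum>i\<le>T. 1 / 2 ^ i) / 2"
    by (simp add: sum_divide_distrib mult.commute)
  also have "\<dots> \<le> 1"
    by (simp add: geometric_half_sum)
  finally have "(\<Sum>e\<in>Sigma {..T} (hyps d). fst (initial d) e) \<le> 1" .
  then show ?thesis
    using hyps_nonempty[OF assms] by (auto simp: admissible_def initial_def)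
qed

lemma sum_index_half_powers: "(\<Sum>i\<le>T. real i / 2 ^ i) = 2 - (real T + 2) / 2 ^ T"
  by (induction T) (auto simp: field_simps)

text \<open>The logarithm of the size of the net grows only linearly in \<open>i\<close>, which is
  summable against \<open>1 / 2 ^ i\<close>; the bound is therefore free of
  \<open>T\<close>.\<close>

lemma potential_initial:
  assumes "d \<ge> 1"
  shows "potential T h (initial d) \<le> 44 * real d * real d"
proof -
  have entry: "- ln (fst (initial d) (i, h i)) - ln (snd (initial d) i (h i)) \<le> (1 + 12 * real d * real d) + (1 + 8 * real d) * real i" for i
  proof -
    have N: "real (card (hyps d i)) > 0"
      using hyps_nonempty[OF assms] by simp
    have 1: "- ln (fst (initial d) (i, h i)) = real (Suc i) * ln 2 + ln (card (hyps d i))"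
      using N by (simp add: initial_def ln_div ln_mult ln_realpow del: power_Suc)
    have 2: "- ln (snd (initial d) i (h i)) = ln (card (hyps d i))"
      using N by (simp add: initial_def ln_div)
    have "real (card (hyps d i)) \<le> real ((2 * (d * 4 ^ i) + 1) ^ (2 * d))"
      using card_hyps_le by (simp only: of_nat_le_iff)
    also have "\<dots> \<le> (3 * real d * 4 ^ i) ^ (2 * d)"
    proof -
      have "1 \<le> real d * 4 ^ i"
        using assms by (metis mult_mono one_le_power of_nat_1 of_nat_mono zero_le_one mult_1 one_le_numeral of_nat_0_le_iff)
      then have "real (2 * (d * 4 ^ i) + 1) \<le> 3 * real d * 4 ^ i"
        by simp
      then show ?thesis
        unfolding of_nat_power by (intro power_mono) auto
    qed
    finally have "ln (card (hyps d i)) \<le> ln ((3 * real d * 4 ^ i) ^ (2 * d))"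
      using N by (intro ln_mono) auto
    also have "\<dots> = 2 * real d * (ln (3 * real d) + real i * ln 4)"
      using assms by (simp add: ln_realpow ln_mult)
    also have "\<dots> \<le> 2 * real d * (3 * real d + real i * 2)"
    proof (intro mult_left_mono add_mono)
      show "ln (3 * real d) \<le> 3 * real d"
        using assms ln_bound[of "3 * real d"] by simp
      have "ln 4 \<le> (2::real)"
        using ln_le_minus_one[of 2] ln_realpow[of "2::real" 2] by simp
      then show "ln 4 \<le> (2::real)" .
    qed auto
    finally have 3: "ln (card (hyps d i)) \<le> 6 * real d * real d + 4 * real d * real i"
      by (simp add: algebra_simps)
    have "real (Suc i) * ln 2 \<le> real (Suc i) * 1"
      using ln_le_minus_one[of "2::real"] by (intro mult_left_mono) auto
    then show ?thesis
      using 1 2 3 by (simp add: algebra_simps)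
  qed
  have "potential T h (initial d) \<le> (\<Sum>i\<le>T. ((1 + 12 * real d * real d) + (1 + 8 * real d) * real i) / 2 ^ i)"
    unfolding potential_def split_def by (intro sum_mono divide_right_mono entry) auto
  also have "\<dots> = (1 + 12 * real d * real d) * (\<Sum>i\<le>T. 1 / 2 ^ i) + (1 + 8 * real d) * (\<Sum>i\<le>T. real i / 2 ^ i)"
    by (simp add: sum_distrib_left sum.distrib[symmetric] add_divide_distrib)
  also have "\<dots> \<le> (1 + 12 * real d * real d) * 2 + (1 + 8 * real d) * 2"
    unfolding geometric_half_sum sum_index_half_powers by (intro add_mono mult_left_mono) auto
  also have "\<dots> \<le> 44 * real d * real d"
  proof -
    have "1 \<le> real d"
      using assms by simp
    moreover from this have "real d * 1 \<le> real d * real d"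
      by (intro mult_left_mono) auto
    moreover have "(1 + 12 * real d * real d) * 2 + (1 + 8 * real d) * 2 = 4 + 24 * (real d * real d) + 16 * real d"
      by (simp add: algebra_simps)
    ultimately show ?thesis
      unfolding mult.assoc by linarith
  qed
  finally show ?thesis .
qed

section \<open>The randomized policy\<close>

text \<open>A policy is a function of the history, so the weights are replayed from it, with the
  earlier prices recomputed from the seeds.\<close>

fun state :: "nat \<Rightarrow> (nat \<Rightarrow> seed) \<Rightarrow> vec list \<Rightarrow> bool list \<Rightarrow> nat \<Rightarrow> (vec \<times> vec) weights" where
  "state d w xs fs 0 = initial d"
| "state d w xs fs (Suc n) =
     (let l = (\<lambda>a. inner_d d (fst a) (xs ! n)); r = (\<lambda>a. inner_d d (snd a) (xs ! n)); \<sigma> = state d w xs fs n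
      in learn (hyps d) n l r \<sigma> (post (hyps d) n l r \<sigma> (w n)) (fs ! n))"

definition trader :: "nat \<Rightarrow> (nat \<Rightarrow> seed) \<Rightarrow> policy" where
  "trader d w xs fs =
     (let n = length xs - 1;
          p = post (hyps d) n (\<lambda>a. inner_d d (fst a) (xs ! n)) (\<lambda>a. inner_d d (snd a) (xs ! n))
                (state d w xs fs n) (w n)
      in (p, p))"

lemma budget_balanced_trader: "budget_balanced d (trader d w)"
  by (simp add: budget_balanced_def prices_def trader_def Let_def)

lemma length_feedback_hist: "length (feedback_hist d \<pi> s b x n) = n"
  by (induction n) (auto simp: Let_def)

lemma nth_feedback_hist:
  "k < n \<Longrightarrow> feedback_hist d \<pi> s b x n ! k \<longleftrightarrow>
     seller_val d s x k \<le> fst (prices d \<pi> s b x k) \<and> snd (prices d \<pi> s b x k) \<le> buyer_val d b x k"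
  by (induction n) (auto simp: Let_def nth_append length_feedback_hist prices_def less_Suc_eq)

section \<open>The policy on a fixed instance\<close>

locale trade_instance =
  fixes d T :: nat and s b :: vec and x :: "nat \<Rightarrow> vec"
  assumes d: "d \<ge> 1" and valid: "valid_instance d s b x T"
begin

abbreviation "lo t \<equiv> \<lambda>a :: vec \<times> vec. inner_d d (fst a) (x t)"
abbreviation "hi t \<equiv> \<lambda>a :: vec \<times> vec. inner_d d (snd a) (x t)"
abbreviation "sv \<equiv> seller_val d s x"
abbreviation "bv \<equiv> buyer_val d b x"

fun run :: "(nat \<Rightarrow> seed) \<Rightarrow> nat \<Rightarrow> (vec \<times> vec) weights" where
  "run w 0 = initial d"
| "run w (Suc t) =
     (let p = post (hyps d) t (lo t) (hi t) (run w t) (w t)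
      in learn (hyps d) t (lo t) (hi t) (run w t) p (sv t \<le> p \<and> p \<le> bv t))"

abbreviation "bid w t \<equiv> post (hyps d) t (lo t) (hi t) (run w t) (w t)"

lemma trader_snoc:
  "trader d w (map x [0..<Suc t]) fs =
     (let p = post (hyps d) t (lo t) (hi t) (state d w (map x [0..<Suc t]) fs t) (w t) in (p, p))"
  by (simp add: trader_def Let_def del: upt_Suc)

text \<open>The replay up to \<open>n\<close> reads only the first \<open>n\<close> entries of a
  longer history. The step uses the induction hypothesis twice: at \<open>m = n\<close> to identify
  the posted price, and at the given \<open>m\<close> to continue.\<close>

lemma state_eq_run: "n \<le> m \<Longrightarrow> state d w (map x [0..<Suc m]) (feedback_hist d (trader d w) s b x m) n = run w n"
proof (induction n arbitrary: m)
  case (Suc n)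
  have "prices d (trader d w) s b x n = (bid w n, bid w n)"
    using Suc.IH[of n] by (simp add: prices_def trader_snoc Let_def del: upt_Suc)
  then have "feedback_hist d (trader d w) s b x m ! n \<longleftrightarrow> sv n \<le> bid w n \<and> bid w n \<le> bv n"
    using Suc.prems by (simp add: nth_feedback_hist)
  then show ?case
    using Suc.IH[of m] Suc.prems by (simp add: Let_def del: upt_Suc)
qed simp

lemma prices_trader: "prices d (trader d w) s b x t = (bid w t, bid w t)"
  using state_eq_run[of t t w] by (simp add: prices_def trader_snoc Let_def del: upt_Suc)

definition loss :: "(nat \<Rightarrow> seed) \<Rightarrow> nat \<Rightarrow> real" where
  "loss w t = (if sv t \<le> bid w t \<and> bid w t \<le> bv t then 0 else max 0 (bv t - sv t))"

text \<open>With one price for both sides a trade implies \<open>sv t \<le> bv t\<close>, so it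
  realises the full positive part.\<close>

lemma gft_trader: "gft d (trader d w) s b x t = max 0 (bv t - sv t) - loss w t"
  by (auto simp: gft_def prices_trader loss_def)

lemma total_gft_trader: "total_gft d (trader d w) s b x n = optimal_gft d s b x n - (\<Sum>t<n. loss w t)"
  by (simp add: total_gft_def optimal_gft_def gft_trader sum_subtractf)

lemma run_cong: "(\<And>i. i < n \<Longrightarrow> w i = w' i) \<Longrightarrow> run w n = run w' n"
  by (induction n) (auto simp: Let_def)

lemma loss_cong: "(\<And>i. i \<le> t \<Longrightarrow> w i = w' i) \<Longrightarrow> loss w t = loss w' t"
  using run_cong[of t w w'] by (simp add: loss_def)

lemma admissible_run: "t \<le> T \<Longrightarrow> admissible (hyps d) T (run w t)"
  by (induction t) (auto simp: Let_def admissible_initial[OF d] intro!: admissible_learn finite_hyps)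

lemma truth_hyps:
  obtains h where "\<And>i. h i \<in> hyps d i"
    "\<And>i t. t < T \<Longrightarrow> \<bar>lo t (h i) - sv t\<bar> \<le> 1 / 4 ^ i" "\<And>i t. t < T \<Longrightarrow> \<bar>hi t (h i) - bv t\<bar> \<le> 1 / 4 ^ i"
proof -
  have s: "in_unit_ball d s" and b: "in_unit_ball d b" and x: "\<And>t. t < T \<Longrightarrow> in_unit_ball d (x t)"
    using valid by (auto simp: valid_instance_def)
  have "\<forall>i. \<exists>w. w \<in> net d i \<and> (\<forall>y. in_unit_ball d y \<longrightarrow> \<bar>inner_d d w y - inner_d d s y\<bar> \<le> 1 / 4 ^ i)"
    using net_approx[OF s d] by metis
  then obtain f where f: "\<And>i. f i \<in> net d i" "\<And>i y. in_unit_ball d y \<Longrightarrow> \<bar>inner_d d (f i) y - inner_d d s y\<bar> \<le> 1 / 4 ^ i"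
    by metis
  have "\<forall>i. \<exists>w. w \<in> net d i \<and> (\<forall>y. in_unit_ball d y \<longrightarrow> \<bar>inner_d d w y - inner_d d b y\<bar> \<le> 1 / 4 ^ i)"
    using net_approx[OF b d] by metis
  then obtain g where g: "\<And>i. g i \<in> net d i" "\<And>i y. in_unit_ball d y \<Longrightarrow> \<bar>inner_d d (g i) y - inner_d d b y\<bar> \<le> 1 / 4 ^ i"
    by metis
  show ?thesis
    using that[of "\<lambda>i. (f i, g i)"] f g x by (simp add: hyps_def seller_val_def buyer_val_def)
qed

text \<open>Only the seed of round \<open>t\<close> varies, and \<open>run w t\<close> does not
  depend on it, so \<open>round_drift\<close> applies with fixed weights.\<close>

lemma drift:
  assumes "t < T" "\<And>i. h i \<in> hyps d i"
    "\<And>i t. t < T \<Longrightarrow> \<bar>lo t (h i) - sv t\<bar> \<le> 1 / 4 ^ i" "\<And>i t. t < T \<Longrightarrow> \<bar>hi t (h i) - bv t\<bar> \<le> 1 / 4 ^ i"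
  shows "(\<Sum>u\<in>seeds t. loss (w(t := u)) t + 64000 * potential T h (run (w(t := u)) (Suc t)))
    \<le> card (seeds t) * (64000 * potential T h (run w t) + 300 / 4 ^ t)"
proof -
  obtain W V where WV: "run w t = (W, V)"
    by (cases "run w t")
  have adm: "admissible (hyps d) T (W, V)"
    using admissible_run[of t w] assms(1) by (simp add: WV)
  have ball: "in_unit_ball d s" "in_unit_ball d b" "in_unit_ball d (x t)"
    using valid assms(1) by (auto simp: valid_instance_def)
  interpret trade_round "hyps d" t T "lo t" "hi t" W V "sv t" "bv t" h
  proof
    show "W (i, a) > 0" "V i a > 0" if "a \<in> hyps d i" for i a
      using adm that by (auto simp: admissible_def)
    show "\<bar>sv t\<bar> \<le> 1" "\<bar>bv t\<bar> \<le> 1"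
      unfolding seller_val_def buyer_val_def using ball by (auto intro: unit_ball_inner)
  qed (use assms in \<open>auto simp: finite_hyps\<close>)
  let ?p = "\<lambda>u. post (hyps d) t (lo t) (hi t) (W, V) u"
  let ?y = "\<lambda>u. sv t \<le> ?p u \<and> ?p u \<le> bv t"
  have run: "run (w(t := u)) t = (W, V)" for u
    using run_cong[of t "w(t := u)" w] WV by simp
  have "(\<Sum>u\<in>seeds t. loss (w(t := u)) t + 64000 * potential T h (run (w(t := u)) (Suc t)))
      = (\<Sum>u\<in>seeds t. if ?y u then 0 else max 0 (bv t - sv t))
        + (\<Sum>u\<in>seeds t. 64000 * potential T h (learn (hyps d) t (lo t) (hi t) (W, V) (?p u) (?y u)))"
    unfolding sum.distrib[symmetric] by (intro sum.cong refl) (simp add: loss_def run Let_def)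
  also have "\<dots> \<le> (\<Sum>u\<in>seeds t. 64000 * (potential T h (W, V) - potential T h (learn (hyps d) t (lo t) (hi t) (W, V) (?p u) (?y u))) + 300 / 4 ^ t)
        + (\<Sum>u\<in>seeds t. 64000 * potential T h (learn (hyps d) t (lo t) (hi t) (W, V) (?p u) (?y u)))"
    by (intro add_right_mono round_drift)
  also have "\<dots> = (\<Sum>u\<in>seeds t. 64000 * potential T h (W, V) + 300 / 4 ^ t)"
    unfolding sum.distrib[symmetric] by (intro sum.cong refl) (simp add: algebra_simps)
  finally show ?thesis
    by (simp add: WV)
qed

end

section \<open>Averages over seeds and the product measure\<close>

definition average :: "nat \<Rightarrow> ((nat \<Rightarrow> seed) \<Rightarrow> real) \<Rightarrow> real" where
  "average n F = (\<Sum>a\<in>Pi\<^sub>E {..<n} seeds. F a) / (\<Prod>i<n. real (card (seeds i)))"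

lemma card_seeds_pos: "real (card (seeds t)) > 0"
  using card_seeds(1)[of t] by (rule less_le_trans[rotated]) simp

lemma average_mono: "(\<And>a. F a \<le> G a) \<Longrightarrow> average n F \<le> average n G"
  unfolding average_def by (intro divide_right_mono sum_mono prod_nonneg) auto

lemma average_const: "average n (\<lambda>_. c) = c"
proof -
  have eq: "real (card (Pi\<^sub>E {..<n} seeds)) = (\<Prod>i<n. real (card (seeds i)))"
    by (simp add: card_PiE)
  have "(\<Prod>i<n. real (card (seeds i))) \<noteq> 0"
    using card_seeds_pos by (simp add: less_imp_neq[symmetric])
  then show ?thesis
    unfolding average_def sum_constant eq by (rule nonzero_mult_div_cancel_left)
qed

lemma average_add: "average n (\<lambda>a. F a + G a) = average n F + average n G"
  by (simp add: average_def sum.distrib add_divide_distrib)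

lemma average_Suc: "average (Suc n) F = average n (\<lambda>a. (\<Sum>u\<in>seeds n. F (a(n := u))) / card (seeds n))"
proof -
  have "(\<Sum>a\<in>Pi\<^sub>E {..<Suc n} seeds. F a) = (\<Sum>(u, a)\<in>seeds n \<times> Pi\<^sub>E {..<n} seeds. F (a(n := u)))"
    unfolding lessThan_Suc PiE_insert_eq
    by (subst sum.reindex[OF inj_combinator]) (simp_all add: split_def)
  also have "\<dots> = (\<Sum>a\<in>Pi\<^sub>E {..<n} seeds. \<Sum>u\<in>seeds n. F (a(n := u)))"
    by (simp only: sum.cartesian_product[symmetric]) (rule sum.swap)
  finally show ?thesis
    by (simp add: average_def sum_divide_distrib[symmetric] mult.commute)
qed

text \<open>The infinite product serves all horizons at once, because the measure on policies is
  chosen before \<open>T\<close>.\<close>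

definition seed_space :: "(nat \<Rightarrow> seed) measure" where
  "seed_space = PiM UNIV (\<lambda>t. measure_pmf (pmf_of_set (seeds t)))"

lemma prob_space_seed_space: "prob_space seed_space"
  unfolding seed_space_def by (intro prob_space_PiM prob_space_measure_pmf)

lemma space_seed_space: "space seed_space = UNIV"
  by (simp add: seed_space_def space_PiM)

lemma cylinder_sets: "{w. \<forall>i<n. w i = a i} \<in> sets seed_space"
proof -
  have "{w \<in> space seed_space. \<forall>i\<in>{..<n}. w i = a i} \<in> sets seed_space"
    unfolding seed_space_def
    by (intro sets.sets_Collect_finite_All sets_Collect_single') auto
  then show ?thesis
    by (simp add: space_seed_space Ball_def)
qed

text \<open>The preimage of any set is a union of cylinders indexed by lists of seeds, of which
  there are countably many.\<close>

lemma measurable_seed_prefix: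
  assumes dep: "\<And>w w'. (\<And>i. i < n \<Longrightarrow> w i = w' i) \<Longrightarrow> F w = F w'"
  shows "F \<in> measurable seed_space (count_space UNIV)"
proof (rule measurableI)
  fix B :: "'a set"
  let ?L = "{l :: seed list. F (\<lambda>i. l ! i) \<in> B}"
  have "F -` B = (\<Union>l\<in>?L. {w. \<forall>i<n. w i = l ! i})"
  proof (intro set_eqI iffI)
    fix w assume "w \<in> F -` B"
    moreover have "F w = F (\<lambda>i. map w [0..<n] ! i)"
      by (intro dep) simp
    ultimately show "w \<in> (\<Union>l\<in>?L. {w. \<forall>i<n. w i = l ! i})"
      by (intro UN_I[of "map w [0..<n]"]) auto
  next
    fix w assume "w \<in> (\<Union>l\<in>?L. {w. \<forall>i<n. w i = l ! i})"
    then obtain l where "F (\<lambda>i. l ! i) \<in> B" "\<forall>i<n. w i = l ! i"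
      by auto
    then show "w \<in> F -` B"
      using dep[of w "\<lambda>i. l ! i"] by simp
  qed
  also have "\<dots> \<in> sets seed_space"
    by (intro sets.countable_UN'' cylinder_sets) auto
  finally show "F -` B \<inter> space seed_space \<in> sets seed_space"
    by (simp add: space_seed_space)
qed simp

lemma measure_cylinder:
  assumes "a \<in> Pi\<^sub>E {..<n} seeds"
  shows "measure seed_space {w. \<forall>i<n. w i = a i} = 1 / (\<Prod>i<n. real (card (seeds i)))"
proof -
  interpret product_prob_space "\<lambda>t. measure_pmf (pmf_of_set (seeds t))" UNIV
    by unfold_locales
  have ne: "seeds i \<noteq> {}" for i
    using card_seeds_pos[of i] by auto
  have "measure seed_space (prod_emb UNIV (\<lambda>t. measure_pmf (pmf_of_set (seeds t))) {..<n} (\<Pi>\<^sub>E i\<in>{..<n}. {a i}))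
      = (\<Prod>i<n. measure (measure_pmf (pmf_of_set (seeds i))) {a i})"
    unfolding seed_space_def by (rule measure_PiM_emb) auto
  also have "prod_emb UNIV (\<lambda>t. measure_pmf (pmf_of_set (seeds t))) {..<n} (\<Pi>\<^sub>E i\<in>{..<n}. {a i}) = {w. \<forall>i<n. w i = a i}"
  proof (intro set_eqI)
    fix w :: "nat \<Rightarrow> seed"
    have "restrict w {..<n} \<in> (\<Pi>\<^sub>E i\<in>{..<n}. {a i}) \<longleftrightarrow> (\<forall>i<n. w i = a i)"
      by (simp only: PiE_iff restrict_extensional restrict_apply singleton_iff lessThan_iff Ball_def simp_thms if_True cong: imp_cong)
    moreover have "w \<in> (\<Pi>\<^sub>E i\<in>UNIV. space (measure_pmf (pmf_of_set (seeds i))))"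
      by simp
    ultimately show "w \<in> prod_emb UNIV (\<lambda>t. measure_pmf (pmf_of_set (seeds t))) {..<n} (\<Pi>\<^sub>E i\<in>{..<n}. {a i})
        \<longleftrightarrow> w \<in> {w. \<forall>i<n. w i = a i}"
      by (simp only: prod_emb_def Int_iff vimage_eq mem_Collect_eq simp_thms)
  qed
  also have "(\<Prod>i<n. measure (measure_pmf (pmf_of_set (seeds i))) {a i}) = (\<Prod>i<n. 1 / real (card (seeds i)))"
  proof (intro prod.cong refl)
    fix i assume "i \<in> {..<n}"
    then have "a i \<in> seeds i"
      using assms by auto
    then show "measure (measure_pmf (pmf_of_set (seeds i))) {a i} = 1 / real (card (seeds i))"
      using ne finite_seeds by (simp add: measure_pmf_single pmf_of_set)
  qed
  finally show ?thesis
    by (simp add: prod_dividef)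
qed

text \<open>Almost surely the first \<open>n\<close> seeds lie in the finite sets
  \<open>seeds i\<close>, where \<open>F\<close> is a finite combination of indicators of cylinders
  of equal probability.\<close>

lemma integral_seed_prefix:
  fixes F :: "(nat \<Rightarrow> seed) \<Rightarrow> real"
  assumes dep: "\<And>w w'. (\<And>i. i < n \<Longrightarrow> w i = w' i) \<Longrightarrow> F w = F w'"
  shows "integrable seed_space F" "(\<integral>w. F w \<partial>seed_space) = average n F"
proof -
  interpret prob_space seed_space
    by (rule prob_space_seed_space)
  let ?C = "\<lambda>a. {w. \<forall>i<n. w i = a i}"
  let ?S = "\<lambda>w. \<Sum>a\<in>Pi\<^sub>E {..<n} seeds. F a * indicator (?C a) w"
  have meas: "F \<in> borel_measurable seed_space"
    using measurable_compose[OF measurable_seed_prefix[of n F, OF dep], of id borel] by simp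
  have fin: "finite (Pi\<^sub>E {..<n} seeds)"
    by (intro finite_PiE) (auto simp: finite_seeds)
  have ne: "seeds i \<noteq> {}" for i
    using card_seeds_pos[of i] by auto
  have "AE w in seed_space. \<forall>i\<in>{..<n}. w i \<in> seeds i"
  proof (intro AE_finite_allI)
    fix i
    have "AE u in measure_pmf (pmf_of_set (seeds i)). u \<in> seeds i"
      using ne finite_seeds by (simp add: AE_measure_pmf_iff)
    then show "AE w in seed_space. w i \<in> seeds i"
      unfolding seed_space_def by (intro AE_PiM_component prob_space_measure_pmf) auto
  qed simp
  then have ae: "AE w in seed_space. F w = ?S w"
  proof (rule AE_mp, intro AE_I2 impI)
    fix w assume w: "\<forall>i\<in>{..<n}. w i \<in> seeds i"
    let ?a = "restrict w {..<n}"
    have a: "?a \<in> Pi\<^sub>E {..<n} seeds"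
      using w by auto
    have "?S w = (\<Sum>a\<in>Pi\<^sub>E {..<n} seeds. if a = ?a then F a else 0)"
    proof (intro sum.cong refl)
      fix a assume "a \<in> Pi\<^sub>E {..<n} seeds"
      then have "w \<in> ?C a \<longleftrightarrow> a = ?a"
        by (auto simp: fun_eq_iff PiE_iff extensional_def)
      then show "F a * indicator (?C a) w = (if a = ?a then F a else 0)"
        by (simp add: indicator_def)
    qed
    also have "\<dots> = F ?a"
      using fin a by simp
    also have "\<dots> = F w"
      by (intro dep) simp
    finally show "F w = ?S w" by simp
  qed
  have int: "integrable seed_space (\<lambda>w. F a * indicator (?C a) w)" for a
    by (intro integrable_mult_right integrable_real_indicator cylinder_sets) (simp add: emeasure_eq_measure)
  have intS: "integrable seed_space ?S"
    by (intro Bochner_Integration.integrable_sum int)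
  then show "integrable seed_space F"
    using integrable_cong_AE[OF meas borel_measurable_integrable[OF intS] ae] by blast
  have "(\<integral>w. F w \<partial>seed_space) = (\<integral>w. ?S w \<partial>seed_space)"
    by (rule integral_cong_AE[OF meas borel_measurable_integrable[OF intS] ae])
  also have "\<dots> = (\<Sum>a\<in>Pi\<^sub>E {..<n} seeds. \<integral>w. F a * indicator (?C a) w \<partial>seed_space)"
    by (intro Bochner_Integration.integral_sum int)
  also have "\<dots> = (\<Sum>a\<in>Pi\<^sub>E {..<n} seeds. F a * (1 / (\<Prod>i<n. real (card (seeds i)))))"
    by (intro sum.cong refl) (simp add: measure_cylinder space_seed_space)
  finally show "(\<integral>w. F w \<partial>seed_space) = average n F"
    by (simp add: average_def sum_divide_distrib)
qed

context trade_instance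
begin

lemma average_loss: "average T (\<lambda>w. \<Sum>t<T. loss w t) \<le> 64000 * (44 * real d * real d) + 400"
proof -
  obtain h where h: "\<And>i. h i \<in> hyps d i"
    "\<And>i t. t < T \<Longrightarrow> \<bar>lo t (h i) - sv t\<bar> \<le> 1 / 4 ^ i" "\<And>i t. t < T \<Longrightarrow> \<bar>hi t (h i) - bv t\<bar> \<le> 1 / 4 ^ i"
    using truth_hyps by metis
  have "average n (\<lambda>w. (\<Sum>t<n. loss w t) + 64000 * potential T h (run w n))
      \<le> 64000 * potential T h (initial d) + 400 * (1 - 1 / 4 ^ n)" if "n \<le> T" for n
    using that
  proof (induction n)
    case 0
    then show ?case by (simp add: average_const)
  next
    case (Suc n)
    have "average (Suc n) (\<lambda>w. (\<Sum>t<Suc n. loss w t) + 64000 * potential T h (run w (Suc n)))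
        \<le> average n (\<lambda>w. ((\<Sum>t<n. loss w t) + 64000 * potential T h (run w n)) + 300 / 4 ^ n)"
      unfolding average_Suc
    proof (rule average_mono)
      fix w :: "nat \<Rightarrow> seed"
      have "(\<Sum>t<n. loss (w(n := u)) t) = (\<Sum>t<n. loss w t)" for u
        by (intro sum.cong refl loss_cong) simp
      then have "(\<Sum>u\<in>seeds n. (\<Sum>t<Suc n. loss (w(n := u)) t) + 64000 * potential T h (run (w(n := u)) (Suc n)))
          = card (seeds n) * (\<Sum>t<n. loss w t)
            + (\<Sum>u\<in>seeds n. loss (w(n := u)) n + 64000 * potential T h (run (w(n := u)) (Suc n)))"
        by (simp add: sum.distrib del: run.simps)
      also have "\<dots> \<le> card (seeds n) * (\<Sum>t<n. loss w t)
          + card (seeds n) * (64000 * potential T h (run w n) + 300 / 4 ^ n)"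
        using drift[of n h w] h Suc.prems by simp
      finally show "(\<Sum>u\<in>seeds n. (\<Sum>t<Suc n. loss (w(n := u)) t) + 64000 * potential T h (run (w(n := u)) (Suc n))) / card (seeds n)
          \<le> ((\<Sum>t<n. loss w t) + 64000 * potential T h (run w n)) + 300 / 4 ^ n"
        using card_seeds_pos[of n] by (simp add: pos_divide_le_eq algebra_simps)
    qed
    also have "\<dots> = average n (\<lambda>w. (\<Sum>t<n. loss w t) + 64000 * potential T h (run w n)) + 300 / 4 ^ n"
      by (simp only: average_add[of n _ "\<lambda>_. 300 / 4 ^ n"] average_const)
    also have "\<dots> \<le> 64000 * potential T h (initial d) + 400 * (1 - 1 / 4 ^ n) + 300 / 4 ^ n"
      using Suc by simp
    finally show ?case
      by simp
  qed
  from this[of T] have "average T (\<lambda>w. (\<Sum>t<T. loss w t) + 64000 * potential T h (run w T))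
      \<le> 64000 * potential T h (initial d) + 400 * (1 - 1 / 4 ^ T)"
    by simp
  moreover have "average T (\<lambda>w. \<Sum>t<T. loss w t) \<le> average T (\<lambda>w. (\<Sum>t<T. loss w t) + 64000 * potential T h (run w T))"
    using potential_nonneg[OF admissible_run finite_hyps h(1)] by (intro average_mono) simp
  moreover have "potential T h (initial d) \<le> 44 * real d * real d"
    by (rule potential_initial[OF d])
  moreover have "400 * (1 - 1 / 4 ^ T) \<le> (400::real)"
    by simp
  ultimately show ?thesis
    by linarith
qed

end

text \<open>
  The \<open>\<sigma>\<close>-algebra is the finest one on the range that makes \<open>trader d\<close> measurable; restricting the space to the
  range keeps only budget balanced policies.
\<close>

definition trader_measure :: "nat \<Rightarrow> policy measure" where
  "trader_measure d = distr seed_space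
     (sigma (range (trader d)) {B. B \<subseteq> range (trader d) \<and> trader d -` B \<in> sets seed_space}) (trader d)"

lemma measurable_trader:
  "trader d \<in> measurable seed_space (sigma (range (trader d)) {B. B \<subseteq> range (trader d) \<and> trader d -` B \<in> sets seed_space})"
  by (rule measurable_measure_of) (auto simp: space_seed_space)

lemma space_trader_measure: "space (trader_measure d) = range (trader d)"
  unfolding trader_measure_def by (simp add: space_measure_of_conv)

text \<open>The \<sigma>-algebra is final for \<open>trader d\<close>, so measurability can be
  tested after composition with it.\<close>

lemma borel_measurable_trader_measure:
  fixes f :: "policy \<Rightarrow> real"
  assumes "(\<lambda>w. f (trader d w)) \<in> borel_measurable seed_space"
  shows "f \<in> borel_measurable (sigma (range (trader d)) {B. B \<subseteq> range (trader d) \<and> trader d -` B \<in> sets seed_space})"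
proof (rule measurableI)
  fix B :: "real set" assume "B \<in> sets borel"
  have "trader d -` (f -` B \<inter> range (trader d)) = (\<lambda>w. f (trader d w)) -` B \<inter> space seed_space"
    by (auto simp: space_seed_space)
  also have "\<dots> \<in> sets seed_space"
    using assms \<open>B \<in> sets borel\<close> by (rule measurable_sets)
  finally have "f -` B \<inter> range (trader d) \<in> {B. B \<subseteq> range (trader d) \<and> trader d -` B \<in> sets seed_space}"
    by simp
  then show "f -` B \<inter> space (sigma (range (trader d)) {B. B \<subseteq> range (trader d) \<and> trader d -` B \<in> sets seed_space})
      \<in> sets (sigma (range (trader d)) {B. B \<subseteq> range (trader d) \<and> trader d -` B \<in> sets seed_space})"
    by (subst space_measure_of, blast, subst sets_measure_of, blast) (rule sigma_sets.Basic)
qed simp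

lemma trader_regret:
  assumes "d \<ge> 1" "valid_instance d s b x T"
  shows "integrable (trader_measure d) (\<lambda>\<pi>. total_gft d \<pi> s b x T)"
    and "expected_regret d (trader_measure d) s b x T \<le> 64000 * (44 * real d * real d) + 400"
proof -
  interpret trade_instance d T s b x
    using assms by unfold_locales
  have dep: "(\<Sum>t<T. loss w t) = (\<Sum>t<T. loss w' t)" if "\<And>i. i < T \<Longrightarrow> w i = w' i" for w w'
    using that by (intro sum.cong refl loss_cong) auto
  note L = integral_seed_prefix[of T "\<lambda>w. \<Sum>t<T. loss w t", OF dep]
  interpret prob_space seed_space
    by (rule prob_space_seed_space)
  have int: "integrable seed_space (\<lambda>w. total_gft d (trader d w) s b x T)"
    unfolding total_gft_trader using L(1) by simp
  note meas = borel_measurable_trader_measure[OF borel_measurable_integrable[OF int]]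
  show "integrable (trader_measure d) (\<lambda>\<pi>. total_gft d \<pi> s b x T)"
    unfolding trader_measure_def using int by (simp add: integrable_distr_eq[OF measurable_trader meas])
  have "(\<integral>\<pi>. total_gft d \<pi> s b x T \<partial>trader_measure d) = (\<integral>w. total_gft d (trader d w) s b x T \<partial>seed_space)"
    unfolding trader_measure_def by (rule integral_distr[OF measurable_trader meas])
  also have "\<dots> = optimal_gft d s b x T - average T (\<lambda>w. \<Sum>t<T. loss w t)"
    unfolding total_gft_trader using L by (simp add: prob_space)
  finally show "expected_regret d (trader_measure d) s b x T \<le> 64000 * (44 * real d * real d) + 400"
    using average_loss by (simp add: expected_regret_def)
qed

theorem theorem4p8:
  shows "\<exists>C::real. \<forall>d::nat. d \<ge> 1 \<longrightarrow>
    (\<exists>M :: policy measure. prob_space M \<and>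
       (\<forall>\<pi>\<in>space M. budget_balanced d \<pi>) \<and>
       (\<forall>s b x T. valid_instance d s b x T \<longrightarrow>
          integrable M (\<lambda>\<pi>. total_gft d \<pi> s b x T) \<and>
          expected_regret d M s b x T \<le> C * real d * 6 ^ d))"
\<comment> \<open>The constant is \<open>64000 * 44 + 400\<close> rounded up;
  \<open>d \<le> 6 ^ d\<close> turns the quadratic bound into the stated one.\<close>
proof (intro exI[of _ 2820000] allI impI)
  fix d :: nat assume d: "d \<ge> 1"
  have bound: "64000 * (44 * real d * real d) + 400 \<le> 2820000 * real d * 6 ^ d"
  proof -
    have "real d \<le> real (6 ^ d)"
      by (intro of_nat_mono less_imp_le power_gt_expt) simp
    then have "real d * real d \<le> real d * 6 ^ d"
      by (intro mult_left_mono) auto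
    moreover have "1 * 1 \<le> real d * real d"
      using d by (intro mult_mono) auto
    ultimately show ?thesis
      by (simp add: mult.assoc)
  qed
  show "\<exists>M :: policy measure. prob_space M \<and> (\<forall>\<pi>\<in>space M. budget_balanced d \<pi>) \<and>
      (\<forall>s b x T. valid_instance d s b x T \<longrightarrow> integrable M (\<lambda>\<pi>. total_gft d \<pi> s b x T) \<and>
        expected_regret d M s b x T \<le> 2820000 * real d * 6 ^ d)"
  proof (intro exI[of _ "trader_measure d"] conjI allI impI ballI)
    show "prob_space (trader_measure d)"
      unfolding trader_measure_def by (intro prob_space.prob_space_distr prob_space_seed_space measurable_trader)
    show "budget_balanced d \<pi>" if "\<pi> \<in> space (trader_measure d)" for \<pi>
      using that budget_balanced_trader by (auto simp: space_trader_measure)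
  next
    fix s b x T assume "valid_instance d s b x T"
    note R = trader_regret[OF d this]
    show "integrable (trader_measure d) (\<lambda>\<pi>. total_gft d \<pi> s b x T)"
      by (rule R)
    show "expected_regret d (trader_measure d) s b x T \<le> 2820000 * real d * 6 ^ d"
      using R(2) bound by linarith
  qed
qed

end
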